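(* Let $P$ be a strictly convex labeled pentagon in $\mathbb{R}^2$ whose vertices are listed in cyclic order, and assume that $P$ is not projectively equivalent, with its cyclic labeling, to a regular pentagon. Let $\mu_1,\mu_2,\mu_3$ be the eigenvalues of $G_P=L_P-3I$ (they are real with pairwise distinct moduli), ordered so that $|\mu_1|>|\mu_2|>|\mu_3|$, and let $u$ be the affine direction of the line through the eigenpoints corresponding to $\mu_1$ and $\mu_2$. Then, as $k\to\infty$, $$\max_i\operatorname{dist}\bigl((\widehat T^k(P))_i,\,C(P)+\mathbb{R}u\bigr)\to0\quad\text{and}\quad\operatorname{diam}\bigl(\widehat T^k(P)\bigr)\to\infty.$$ More precisely, $$\max_i\operatorname{dist}\bigl((\widehat T^k(P))_i,\,C(P)+\mathbb{R}u\bigr)=O\!\left(\left|\frac{\mu_3}{\mu_2}\right|^{k/2}\right),$$ and there exists a constant $D(P)>0$ such that $$\operatorname{diam}\bigl(\widehat T^k(P)\bigr)\sim D(P)\left|\frac{\mu_2}{\mu_3}\right|^{k/2}.$$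
   Context: Labeled polygons: $P=(p_1,\dots,p_n)$, $p_i\in\mathbb{R}^2$, indices modulo $n$ (here $n=5$); $\mathbb{R}^2\subset\mathbb{RP}^2$ via $x\mapsto[x:1]$. Pentagram map: $T(P)_i=(p_ip_{i+2})\cap(p_{i+1}p_{i+3})$. $C(P)=\frac1n\sum_ip_i$, $\operatorname{Area}(P)=\bigl|\frac12\sum_i\det(p_i,p_{i+1})\bigr|$. Area-normalized pentagram map: $\widehat T(P)_i=C(P)+\sqrt{\operatorname{Area}(P)/\operatorname{Area}(T(P))}\,(T(P)_i-C(T(P)))$. Glick's operator, for a labeled $n$-gon with every consecutive triple of vertices noncollinear and nonzero homogeneous lifts $\widetilde p_i\in\mathbb{R}^3$: $$L_P(v)=nv-\sum_{j=1}^n\frac{\det(\widetilde p_{j-1},v,\widetilde p_{j+1})}{\det(\widetilde p_{j-1},\widetilde p_j,\widetilde p_{j+1})}\,\widetilde p_j ,\qquad v\in\mathbb{R}^3$$ (independent of the lifts). An eigenpoint is the projective class of an eigenvector. *)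

theory Defs
  imports "HOL-Analysis.Analysis" "HOL-Library.Landau_Symbols"
begin

text \<open>
  The index type is the numeral type 5, whose arithmetic is arithmetic modulo 5, so that
  \<open>i + 2\<close> and \<open>i - 1\<close> are cyclic shifts of the label \<open>i\<close>.
\<close>

type_synonym pentagon = "5 \<Rightarrow> real^2"

definition det2 :: "real^2 \<Rightarrow> real^2 \<Rightarrow> real" where
  "det2 a b = det (vector [a, b] :: real^2^2)"

definition det3 :: "real^3 \<Rightarrow> real^3 \<Rightarrow> real^3 \<Rightarrow> real" where
  "det3 a b c = det (vector [a, b, c] :: real^3^3)"

text \<open>
  Each side lies on a line that has the three other vertices strictly on one side. This is
  strict convexity together with the vertices being listed in cyclic order (of either orientation):
  it forces distinct vertices and excludes star-shaped labelings.
\<close>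

definition strictly_convex_pentagon :: "pentagon \<Rightarrow> bool" where
  "strictly_convex_pentagon P \<longleftrightarrow>
     (\<forall>i. \<exists>a b. a \<bullet> P i = b \<and> a \<bullet> P (i + 1) = b \<and> (\<forall>j. j \<notin> {i, i + 1} \<longrightarrow> a \<bullet> P j < b))"

definition rotate2 :: "real \<Rightarrow> real^2 \<Rightarrow> real^2" where
  "rotate2 t x = vector [cos t * x $ 1 - sin t * x $ 2, sin t * x $ 1 + cos t * x $ 2]"

text \<open>
  The angles \<open>2\<pi>/5\<close> and \<open>-2\<pi>/5\<close> are the two orientations of the cyclic labeling; angles
  \<open>\<plusminus>4\<pi>/5\<close>, which give the star labelings, are not allowed.
\<close>

definition regular_pentagon :: "pentagon \<Rightarrow> bool" where
  "regular_pentagon Q \<longleftrightarrow>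
     (\<exists>c. \<exists>t\<in>{2 * pi / 5, - 2 * pi / 5}. Q 0 \<noteq> c \<and> (\<forall>i. Q (i + 1) = c + rotate2 t (Q i - c)))"

text \<open>
  Points of the real projective plane are represented by nonzero vectors of \<open>real^3\<close> up to nonzero
  scalars, and projective transformations by invertible matrices. The map \<open>lift\<close> represents
  \<open>x \<mapsto> [x : 1]\<close>.
\<close>

definition lift :: "real^2 \<Rightarrow> real^3" where
  "lift x = vector [x $ 1, x $ 2, 1]"

definition projectively_equivalent :: "pentagon \<Rightarrow> pentagon \<Rightarrow> bool" where
  "projectively_equivalent P Q \<longleftrightarrow>
     (\<exists>M :: real^3^3. invertible M \<and> (\<forall>i. \<exists>c. c \<noteq> 0 \<and> M *v lift (P i) = c *\<^sub>R lift (Q i)))"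

text \<open>
  The two diagonals meet in exactly one point of the affine plane when the pentagon is strictly
  convex; \<open>THE\<close> is meaningful in that case.
\<close>

definition pentagram :: "pentagon \<Rightarrow> pentagon" where
  "pentagram P i =
     (THE x. x \<in> affine hull {P i, P (i + 2)} \<inter> affine hull {P (i + 1), P (i + 3)})"

definition centroid :: "pentagon \<Rightarrow> real^2" where
  "centroid P = (1 / 5) *\<^sub>R (\<Sum>i\<in>UNIV. P i)"

definition area :: "pentagon \<Rightarrow> real" where
  "area P = \<bar>(1 / 2) * (\<Sum>i\<in>UNIV. det2 (P i) (P (i + 1)))\<bar>"

definition normalized_pentagram :: "pentagon \<Rightarrow> pentagon" where
  "normalized_pentagram P i =
     centroid P + sqrt (area P / area (pentagram P)) *\<^sub>R (pentagram P i - centroid (pentagram P))"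

text \<open>
  Glick's operator does not depend on the homogeneous lifts of the vertices; the lifts with last
  coordinate 1 are used.
\<close>

definition glick :: "pentagon \<Rightarrow> real^3 \<Rightarrow> real^3" where
  "glick P v = 5 *\<^sub>R v -
     (\<Sum>j\<in>UNIV. (det3 (lift (P (j - 1))) v (lift (P (j + 1)))
        / det3 (lift (P (j - 1))) (lift (P j)) (lift (P (j + 1)))) *\<^sub>R lift (P j))"

definition glick_shifted :: "pentagon \<Rightarrow> real^3 \<Rightarrow> real^3" where
  "glick_shifted P v = glick P v - 3 *\<^sub>R v"

definition eigenvector_for :: "(real^3 \<Rightarrow> real^3) \<Rightarrow> real \<Rightarrow> real^3 \<Rightarrow> bool" where
  "eigenvector_for f \<mu> v \<longleftrightarrow> v \<noteq> 0 \<and> f v = \<mu> *\<^sub>R v"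

definition eigenvalues :: "(real^3 \<Rightarrow> real^3) \<Rightarrow> real set" where
  "eigenvalues f = {\<mu>. \<exists>v. eigenvector_for f \<mu> v}"

text \<open>
  If the modulus-ordered triple below consists of real eigenvalues, then it exhausts the spectrum of
  an operator on a 3-dimensional space (complex eigenvalues included), each eigenvalue is
  simple, and the triple is uniquely determined.
\<close>

definition ordered_eigenvalues :: "(real^3 \<Rightarrow> real^3) \<Rightarrow> real \<Rightarrow> real \<Rightarrow> real \<Rightarrow> bool" where
  "ordered_eigenvalues f \<mu>1 \<mu>2 \<mu>3 \<longleftrightarrow>
     eigenvalues f = {\<mu>1, \<mu>2, \<mu>3} \<and> \<bar>\<mu>1\<bar> > \<bar>\<mu>2\<bar> \<and> \<bar>\<mu>2\<bar> > \<bar>\<mu>3\<bar>"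

text \<open>
  The affine part of the projective line through \<open>[v]\<close> and \<open>[w]\<close>. It is empty when
  that line is the line at infinity, which then has no affine direction.
\<close>

definition line_affine_part :: "real^3 \<Rightarrow> real^3 \<Rightarrow> (real^2) set" where
  "line_affine_part v w = {x. lift x \<in> span {v, w}}"

definition line_through :: "real^2 \<Rightarrow> real^2 \<Rightarrow> (real^2) set" where
  "line_through a u = {a + t *\<^sub>R u | t. True}"

definition affine_direction :: "real^3 \<Rightarrow> real^3 \<Rightarrow> real^2 \<Rightarrow> bool" where
  "affine_direction v w u \<longleftrightarrow> u \<noteq> 0 \<and> (\<exists>a. line_affine_part v w = line_through a u)"

definition max_dist_to_line :: "pentagon \<Rightarrow> (real^2) set \<Rightarrow> real" where
  "max_dist_to_line Q l = (MAX i. infdist (Q i) l)"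

definition diam :: "pentagon \<Rightarrow> real" where
  "diam Q = diameter (range Q)"

end

(*
  In homogeneous coordinates the shifted operator G = L_P - 3 I maps the lift of p_i to a positive
  multiple of the lift of T(P)_{i+1}. It is natural under linear maps and independent of lifts and
  labels, so G_{T(P)} = G_P, and T^k(P) is the projective image of P under G^k, relabelled by k.
  With lifts for which all determinants of consecutive triples agree, the remaining determinants
  satisfy the frieze relations of Gauss's pentagramma mirificum, and the characteristic equation of
  G is x^2 (x - 1) = Y (x + 1), Y being the product of the five frieze entries. An AM-GM type bound
  gives Y > phi^5 (phi the golden ratio) unless P is projectively regular, and then one root is
  positive and dominant while the two others are negative with distinct moduli. The iterates of the
  cone over P stay in a fixed cone, so the leading eigencoordinate of every vertex is nonzero and
  of one sign. Hence T^k(P) shrinks to an affine point at rate |mu_2/mu_1|^k in the direction u and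
  |mu_3/mu_1|^k transversally, and dividing by the square root of the area, which is of order
  |mu_2 mu_3/mu_1^2|^(k/2), leaves the factors |mu_2/mu_3|^(k/2) and |mu_3/mu_2|^(k/2).
*)
theory Submission
  imports Defs
begin

section \<open>Determinants and labels\<close>

text \<open>The projectively regular class has to be excluded because at \<open>Y = phi^5\<close>
  the two negative roots collide at \<open>-phi\<close>, so that no direction is distinguished. Away
  from it, two degenerations could still spoil the rates. The limit point might lie at infinity, or
  a vertex might have no component along the leading eigenvector; both are ruled out because G maps
  a vertex to a combination of vertices with positive coefficients, a Perron-Frobenius situation.
  The leading coefficient of the area might vanish; it does not, because the quotients of
  eigencoordinates are themselves the vertices of a convex pentagon, and the coefficient is its area
  up to a nonzero factor. Area normalization is not projectively natural, but the pentagram map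
  commutes with homotheties, so the normalizing factors telescope and only the plain iterates have
  to be understood.\<close>

lemma exhaust_5:
  fixes i :: 5
  shows "i = 0 \<or> i = 1 \<or> i = 2 \<or> i = 3 \<or> i = 4"
proof (induct i)
  case (of_int z)
  then have "z = 0 \<or> z = 1 \<or> z = 2 \<or> z = 3 \<or> z = 4" by auto
  then show ?case by auto
qed

text \<open>Adding label offsets such as \<open>3 + 4\<close> leaves numerals from 5 on; these rules
  bring them back below 5.\<close>

lemma five_numerals [simp]: "(5::5) = 0" "(6::5) = 1" "(7::5) = 2" "(8::5) = 3" "(9::5) = 4"
  by simp_all

lemma UNIV_5: "(UNIV :: 5 set) = {i, i + 1, i + 2, i + 3, i + 4}"
proof -
  have "j \<in> {i, i + 1, i + 2, i + 3, i + 4}" for j :: 5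
    using exhaust_5[of "j - i"] by (auto simp: algebra_simps)
  then show ?thesis by blast
qed

text \<open>The starting label is free, so that a cyclic sum can be expanded around the vertex under
  consideration.\<close>

lemma sum_5: "(\<Sum>j\<in>UNIV. f j) = f i + f (i + 1) + f (i + 2) + f (i + 3) + f (i + 4)"
  for i :: 5 and f :: "5 \<Rightarrow> 'a::comm_monoid_add"
proof -
  have "i + a \<noteq> i + b" if "a \<noteq> b" for a b :: 5
    using that by simp
  then show ?thesis
    unfolding UNIV_5[of i] by (simp add: add.assoc)
qed

lemma sum_relabel: "(\<Sum>i\<in>UNIV. f (i + s)) = (\<Sum>i\<in>UNIV. f i)"
  for s :: 5 and f :: "5 \<Rightarrow> 'a::comm_monoid_add"
  by (rule sum.reindex_bij_witness[of _ "\<lambda>j. j - s" "\<lambda>j. j + s"]) auto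

lemma det2_expand: "det2 a b = a $ 1 * b $ 2 - a $ 2 * b $ 1"
  by (simp add: det2_def det_2)

lemma det3_expand: "det3 a b c = a $ 1 * b $ 2 * c $ 3 + a $ 2 * b $ 3 * c $ 1 + a $ 3 * b $ 1 * c $ 2
   - a $ 1 * b $ 3 * c $ 2 - a $ 2 * b $ 1 * c $ 3 - a $ 3 * b $ 2 * c $ 1"
  by (simp add: det3_def det_3)

lemma det3_rotate: "det3 b c a = det3 a b c"
  by (simp add: det3_expand)

lemma det3_scale: "det3 (r *\<^sub>R a) (s *\<^sub>R b) (t *\<^sub>R c) = r * s * t * det3 a b c"
  by (simp add: det3_expand algebra_simps)

lemma cramer3:
  "det3 a b c *\<^sub>R v = det3 v b c *\<^sub>R a + det3 a v c *\<^sub>R b + det3 a b v *\<^sub>R c"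
  by (simp add: vec_eq_iff forall_3 det3_expand algebra_simps)

lemma det3_lincomb:
  "det3 (a11 *\<^sub>R x + a12 *\<^sub>R y + a13 *\<^sub>R z) (a21 *\<^sub>R x + a22 *\<^sub>R y + a23 *\<^sub>R z)
        (a31 *\<^sub>R x + a32 *\<^sub>R y + a33 *\<^sub>R z) =
   (a11 * a22 * a33 + a12 * a23 * a31 + a13 * a21 * a32
    - a11 * a23 * a32 - a12 * a21 * a33 - a13 * a22 * a31) * det3 x y z"
  by (simp add: det3_expand algebra_simps)

lemma det3_linear:
  assumes "linear f"
  shows "det3 (f a) (f b) (f c) = det (matrix f) * det3 a b c"
proof -
  have f: "f x $ i = matrix f $ i $ 1 * x $ 1 + matrix f $ i $ 2 * x $ 2 + matrix f $ i $ 3 * x $ 3"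
      for x i
    using matrix_vector_mul(2)[OF assms, THEN fun_cong, of x]
    by (simp add: matrix_vector_mult_def sum_3 vec_eq_iff)
  have "vector [f a, f b, f c] = (vector [a, b, c] :: real^3^3) ** transpose (matrix f)"
    by (simp add: vec_eq_iff forall_3 matrix_matrix_mult_def transpose_def f sum_3 mult.commute)
  then show ?thesis
    by (simp add: det3_def det_mul)
qed

lemma det3_zero_imp_dependent:
  assumes "det3 a b c = 0"
  shows "\<exists>x y z. (x, y, z) \<noteq> (0, 0, 0) \<and> x *\<^sub>R a + y *\<^sub>R b + z *\<^sub>R c = 0"
proof -
  have "det (transpose (vector [a, b, c] :: real^3^3)) = 0"
    using assms by (simp add: det3_def)
  then obtain x where x: "x \<noteq> 0" "transpose (vector [a, b, c] :: real^3^3) *v x = 0"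
    by (metis invertible_det_nz invertible_left_inverse matrix_left_invertible_ker)
  then show ?thesis
    by (intro exI[of _ "x $ 1"] exI[of _ "x $ 2"] exI[of _ "x $ 3"])
      (simp add: vec_eq_iff forall_3 transpose_def matrix_vector_mult_def sum_3 mult.commute)
qed

lemma lift_nth [simp]: "lift x $ 1 = x $ 1" "lift x $ 2 = x $ 2" "lift x $ 3 = 1"
  by (simp_all add: lift_def)

section \<open>The shifted operator on lifts\<close>

text \<open>\<open>L_P - 3 I\<close> for arbitrary lifts, with \<open>2 = 5 - 3\<close>. The frieze
  normalization and the images under powers of the operator use lifts whose third coordinate is not
  1.\<close>

definition shifted_glick :: "(5 \<Rightarrow> real^3) \<Rightarrow> real^3 \<Rightarrow> real^3" where
  "shifted_glick p v = 2 *\<^sub>R v -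
     (\<Sum>j\<in>UNIV. (det3 (p (j - 1)) v (p (j + 1)) / det3 (p (j - 1)) (p j) (p (j + 1))) *\<^sub>R p j)"

lemma glick_shifted_eq: "glick_shifted P = shifted_glick (\<lambda>i. lift (P i))"
  by (simp add: fun_eq_iff glick_shifted_def glick_def shifted_glick_def algebra_simps flip:
      scaleR_left.add)

lemma linear_shifted_glick: "linear (shifted_glick p)"
proof -
  have "det3 a (v + w) b = det3 a v b + det3 a w b" "det3 a (r *\<^sub>R v) b = r * det3 a v b" for a b v w r
    by (simp_all add: det3_expand algebra_simps)
  then have "linear (\<lambda>v. (det3 a v b / d) *\<^sub>R c)" for a b c d
    by (intro linearI) (simp_all add: add_divide_distrib scaleR_left_distrib)
  then have "linear (\<lambda>v. 2 *\<^sub>R v - (\<Sum>j\<in>UNIV. (det3 (p (j - 1)) v (p (j + 1)) / det3 (p (j - 1)) (p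
      j) (p (j + 1))) *\<^sub>R p j))"
    by (intro linear_compose_sub linear_compose_sum ballI) (auto intro: linear_scale_self)
  then show ?thesis
    by (simp add: shifted_glick_def[abs_def])
qed

text \<open>The factors of the neighbours of \<open>j\<close> cancel in the quotient, and the factor
  \<open>c j\<close> in the denominator cancels against the rescaled vertex.\<close>

lemma shifted_glick_scale:
  assumes "\<And>i. c i \<noteq> 0"
  shows "shifted_glick (\<lambda>i. c i *\<^sub>R p i) v = shifted_glick p v"
proof -
  have "(det3 (c (j - 1) *\<^sub>R p (j - 1)) v (c (j + 1) *\<^sub>R p (j + 1))
         / det3 (c (j - 1) *\<^sub>R p (j - 1)) (c j *\<^sub>R p j) (c (j + 1) *\<^sub>R p (j + 1))) *\<^sub>R (c j *\<^sub>R p j)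
       = (det3 (p (j - 1)) v (p (j + 1)) / det3 (p (j - 1)) (p j) (p (j + 1))) *\<^sub>R p j" for j
    using assms[of j] assms[of "j-1"] assms[of "j+1"] det3_scale[of "c (j-1)" "p (j-1)" 1 v "c
        (j+1)" "p (j+1)"]
    by (simp add: det3_scale)
  then show ?thesis
    unfolding shifted_glick_def by presburger
qed

text \<open>Numerator and denominator of each coefficient acquire the same factor
  \<open>det (matrix f)\<close>.\<close>

lemma shifted_glick_linear_image:
  assumes "linear f" "det (matrix f) \<noteq> 0"
  shows "shifted_glick (\<lambda>i. f (p i)) (f v) = f (shifted_glick p v)"
  using assms(2) unfolding shifted_glick_def
  by (simp add: det3_linear[OF assms(1)] linear_diff[OF assms(1)] linear_sum[OF assms(1)]
      linear_cmul[OF assms(1)])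

lemma shifted_glick_relabel: "shifted_glick (\<lambda>i. p (i + s)) = shifted_glick p"
proof -
  note * = sum_relabel[of "\<lambda>j. (det3 (p (j - 1)) v (p (j + 1)) / det3 (p (j - 1)) (p j) (p (j + 1)))
      *\<^sub>R p j" s for v]
  show ?thesis
    unfolding fun_eq_iff shifted_glick_def *[symmetric] by (simp add: algebra_simps)
qed

text \<open>
  Vectors whose classes are the vertices of a convex pentagon, in a chart in which all lifts are
  positive; \<open>\<sigma>\<close> only matters through its sign, the orientation. The indices of the second
  determinant run over all triples that are not consecutive.
\<close>

definition convex_lifts :: "real \<Rightarrow> (5 \<Rightarrow> real^3) \<Rightarrow> bool" where
  "convex_lifts \<sigma> p \<longleftrightarrow>
     (\<forall>i. 0 < \<sigma> * det3 (p i) (p (i + 1)) (p (i + 2)) \<and> 0 < \<sigma> * det3 (p i) (p (i + 1)) (p (i + 3)))"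

text \<open>For \<open>v = p i\<close> the summand at \<open>j = i\<close> is \<open>p i\<close>,
  those at the two neighbours have a repeated vector, and in the other two a transposition turns the
  minus sign before the sum into plus.\<close>

lemma shifted_glick_vertex:
  assumes "\<And>i. det3 (p i) (p (i + 1)) (p (i + 2)) \<noteq> 0"
  shows "shifted_glick p (p i) = p i
    + (det3 (p i) (p (i + 1)) (p (i + 3)) / det3 (p (i + 1)) (p (i + 2)) (p (i + 3))) *\<^sub>R p (i + 2)
    + (det3 (p i) (p (i + 2)) (p (i + 4)) / det3 (p (i + 2)) (p (i + 3)) (p (i + 4))) *\<^sub>R p (i + 3)"
proof -
  let ?T = "\<lambda>j. (det3 (p (j - 1)) (p i) (p (j + 1)) / det3 (p (j - 1)) (p j) (p (j + 1))) *\<^sub>R p j"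
  have det: "det3 a a b = 0" "det3 b a a = 0" "det3 b a c = - det3 a b c" for a b c
    by (simp_all add: det3_expand)
  have idx: "i + 1 - 1 = i" "i + 2 - 1 = i + 1" "i + 3 - 1 = i + 2" "i + 4 - 1 = i + 3" "i + 2 + 1 =
      i + 3" "i + 3 + 1 = i + 4" "i + 4 + 1 = i"
    by simp_all
  have "i - 1 + 1 = i" "i - 1 + 2 = i + 1" by simp_all
  then have "det3 (p (i - 1)) (p i) (p (i + 1)) \<noteq> 0"
    using assms[of "i - 1"] by (simp only: simp_thms)
  then have T0: "?T i = p i" by simp
  have T14: "?T (i + 1) = 0" "?T (i + 4) = 0"
    unfolding idx by (simp_all add: det(1,2))
  have T2: "?T (i + 2) = - ((det3 (p i) (p (i + 1)) (p (i + 3)) / det3 (p (i + 1)) (p (i + 2)) (p (i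
      + 3))) *\<^sub>R p (i + 2))"
    unfolding idx det(3)[of "p (i + 1)" "p i" "p (i + 3)"] by simp
  have T3: "?T (i + 3) = - ((det3 (p i) (p (i + 2)) (p (i + 4)) / det3 (p (i + 2)) (p (i + 3)) (p (i
      + 4))) *\<^sub>R p (i + 3))"
    unfolding idx det(3)[of "p (i + 2)" "p i" "p (i + 4)"] by simp
  have "shifted_glick p (p i) = 2 *\<^sub>R p i - (?T i + ?T (i + 1) + ?T (i + 2) + ?T (i + 3) + ?T (i + 4))"
    unfolding shifted_glick_def sum_5[of ?T i] ..
  then show ?thesis
    unfolding T0 T14 T2 T3 by (simp add: scaleR_2)
qed

text \<open>Positivity of the two coefficients makes the cone spanned by the lifts invariant under
  the operator.\<close>

lemma shifted_glick_vertex_pos: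
  assumes "convex_lifts \<sigma> p"
  obtains a b where "a > 0" "b > 0" "shifted_glick p (p i) = p i + a *\<^sub>R p (i + 2) + b *\<^sub>R p (i + 3)"
proof (rule that)
  have pos: "0 < \<sigma> * det3 (p i) (p (i + 1)) (p (i + 2))" "0 < \<sigma> * det3 (p i) (p (i + 1)) (p (i +
      3))" for i
    using assms by (auto simp: convex_lifts_def)
  have "det3 (p (i+4)) (p i) (p (i+2)) = det3 (p i) (p (i + 2)) (p (i + 4))"
    by (simp add: det3_expand)
  then show "det3 (p i) (p (i + 1)) (p (i + 3)) / det3 (p (i + 1)) (p (i + 2)) (p (i + 3)) > 0"
    "det3 (p i) (p (i + 2)) (p (i + 4)) / det3 (p (i + 2)) (p (i + 3)) (p (i + 4)) > 0"
    using pos[of i] pos[of "i + 1"] pos[of "i + 2"] pos[of "i + 4"]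
    by (auto simp: zero_less_divide_iff zero_less_mult_iff add.assoc)
  show "shifted_glick p (p i) = p i
    + (det3 (p i) (p (i + 1)) (p (i + 3)) / det3 (p (i + 1)) (p (i + 2)) (p (i + 3))) *\<^sub>R p (i + 2)
    + (det3 (p i) (p (i + 2)) (p (i + 4)) / det3 (p (i + 2)) (p (i + 3)) (p (i + 4))) *\<^sub>R p (i + 3)"
    using pos by (intro shifted_glick_vertex) (metis less_irrefl mult_zero_right)
qed

text \<open>The supporting functional of a side is a multiple of the determinant with its two
  endpoints, so these determinants have one sign per side; adjacent sides share a triangle, which
  makes their signs agree.\<close>

lemma strictly_convex_imp_convex_lifts:
  assumes "strictly_convex_pentagon P"
  obtains \<sigma> where "convex_lifts \<sigma> (\<lambda>i. lift (P i))"
proof -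
  let ?d = "\<lambda>i j. det3 (lift (P i)) (lift (P (i + 1))) (lift (P j))"
  have "\<exists>\<tau>. \<forall>j. j \<notin> {i, i + 1} \<longrightarrow> 0 < \<tau> * ?d i j" for i
  proof -
    obtain a b where ab: "a \<bullet> P i = b" "a \<bullet> P (i + 1) = b" "\<And>j. j \<notin> {i, i + 1} \<Longrightarrow> a \<bullet> P j < b"
      using assms by (meson strictly_convex_pentagon_def)
    \<comment> \<open>The next side separates \<open>P i\<close> from \<open>P (i + 1)\<close>, so
      that the edge vector \<open>e\<close> is nonzero.\<close>
    obtain a' b' where ab': "a' \<bullet> P (i + 1) = b'" "\<And>j. j \<notin> {i + 1, i + 1 + 1} \<Longrightarrow> a' \<bullet> P j < b'"
      using assms by (meson strictly_convex_pentagon_def)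
    define e where "e = P (i + 1) - P i"
    \<comment> \<open>As \<open>a\<close> is orthogonal to \<open>e\<close>, it is a multiple of
      \<open>e\<close> turned by a right angle; \<open>c\<close> is that multiple times
      \<open>e \<bullet> e\<close> and carries the orientation.\<close>
    define c where "c = e $ 2 * a $ 1 - e $ 1 * a $ 2"
    have "a' \<bullet> P i < b'" using ab'(2)[of i] by simp
    then have "e \<noteq> 0" using ab'(1) unfolding e_def by force
    have "a \<bullet> P (i + 2) < b" using ab(3)[of "i + 2"] by simp
    then have "a \<noteq> 0" using ab(1) by force
    have ae: "a \<bullet> e = 0" using ab by (simp add: e_def inner_diff_right)
    have "c\<^sup>2 = (a \<bullet> a) * (e \<bullet> e)"
    proof -
      have "c\<^sup>2 + (a \<bullet> e)\<^sup>2 = (a \<bullet> a) * (e \<bullet> e)"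
        by (simp add: c_def inner_vec_def sum_2 power2_eq_square algebra_simps)
      then show ?thesis using ae by simp
    qed
    with \<open>a \<noteq> 0\<close> \<open>e \<noteq> 0\<close> have "c\<^sup>2 > 0" by simp
    have "0 < c * ?d i j" if "j \<notin> {i, i + 1}" for j
    proof -
      have ae': "a $ 1 * e $ 1 + a $ 2 * e $ 2 = 0" using ae by (simp add: inner_vec_def sum_2)
      have d: "?d i j = e $ 1 * (P j $ 2 - P i $ 2) - e $ 2 * (P j $ 1 - P i $ 1)"
        by (simp add: det3_expand e_def algebra_simps)
      have b: "b - a \<bullet> P j = - (a $ 1 * (P j $ 1 - P i $ 1) + a $ 2 * (P j $ 2 - P i $ 2))"
        unfolding ab(1)[symmetric] by (simp add: inner_vec_def sum_2 algebra_simps)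
      have "(a \<bullet> a) * ?d i j = c * (b - a \<bullet> P j)"
      proof -
        have "(a \<bullet> a) * ?d i j - c * (b - a \<bullet> P j) = (a $ 1 * (P j $ 2 - P i $ 2) - a $ 2 * (P j $ 1
            - P i $ 1))
            * (a $ 1 * e $ 1 + a $ 2 * e $ 2)"
          unfolding d b by (simp add: inner_vec_def sum_2 c_def algebra_simps)
        then show ?thesis using ae' by simp
      qed
      then have "(a \<bullet> a) * (c * ?d i j) = c\<^sup>2 * (b - a \<bullet> P j)"
        by (metis mult.assoc mult.left_commute power2_eq_square)
      then have "0 < (a \<bullet> a) * (c * ?d i j)"
        using \<open>c\<^sup>2 > 0\<close> ab(3)[OF that] by simp
      then show ?thesis using \<open>a \<noteq> 0\<close> by (metis inner_gt_zero_iff zero_less_mult_pos)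
    qed
    then show ?thesis by blast
  qed
  then obtain \<tau> where \<tau>: "\<And>i j. j \<notin> {i, i + 1} \<Longrightarrow> 0 < \<tau> i * ?d i j" by metis
  have "sgn (\<tau> (i + 1)) = sgn (\<tau> i)" for i
  proof -
    have "?d (i + 1) i = ?d i (i + 2)"
      by (simp add: det3_rotate add.assoc)
    with \<tau>[of i "i + 1"] \<tau>[of "i + 2" i] show ?thesis
      by (auto simp: zero_less_mult_iff)
  qed
  from this[of 0] this[of 1] this[of 2] this[of 3]
  have sgn: "sgn (\<tau> i) = sgn (\<tau> 0)" for i
    using exhaust_5[of i] by auto
  show ?thesis
  proof (rule that[of "\<tau> 0"], unfold convex_lifts_def, intro allI conjI)
    fix i
    have "0 < \<tau> 0 * ?d i j" if "j \<notin> {i, i + 1}" for j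
      using \<tau>[OF that] sgn[of i] by (auto simp: zero_less_mult_iff sgn_if split: if_splits)
    from this[of "i + 2"] this[of "i + 3"]
    show "0 < \<tau> 0 * ?d i (i + 2)" "0 < \<tau> 0 * ?d i (i + 3)" by auto
  qed
qed

section \<open>Frieze normal form\<close>

text \<open>Rescaling makes all consecutive determinants equal. Expanding the last two lifts in the
  first three then leaves four unknown coefficients, and two of the normalizations eliminate two of
  them. The five frieze entries are \<open>u\<close>, \<open>v\<close>, \<open>(1 + u) / v\<close>,
  \<open>(1 + u + v) / (u * v)\<close> and \<open>(1 + v) / u\<close>.\<close>

lemma frieze_form:
  assumes "convex_lifts \<sigma> p"
  obtains c :: "5 \<Rightarrow> real" and u v where "\<And>i. c i > 0" "u > 0" "v > 0"
    "det3 (c 0 *\<^sub>R p 0) (c 1 *\<^sub>R p 1) (c 2 *\<^sub>R p 2) \<noteq> 0"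
    "c 3 *\<^sub>R p 3 = c 0 *\<^sub>R p 0 + (- u) *\<^sub>R (c 1 *\<^sub>R p 1) + v *\<^sub>R (c 2 *\<^sub>R p 2)"
    "c 4 *\<^sub>R p 4 = ((1 + u + v) / (u * v)) *\<^sub>R (c 0 *\<^sub>R p 0) + (- ((1 + u) / v)) *\<^sub>R (c 1 *\<^sub>R p 1) +
        1 *\<^sub>R (c 2 *\<^sub>R p 2)"
proof -
  define d where "d i = det3 (p i) (p (i + 1)) (p (i + 2))" for i
  have pos: "0 < \<sigma> * d i" "0 < \<sigma> * det3 (p i) (p (i + 1)) (p (i + 3))" for i
    using assms by (auto simp: convex_lifts_def d_def)
  then have d0: "d i \<noteq> 0" for i by (metis less_irrefl mult_zero_right)
  \<comment> \<open>Over three consecutive labels from \<open>i\<close> on, the denominators contain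
    \<open>d i\<close> twice and every other \<open>d j\<close> once; the surplus cancels against
    the determinant \<open>d i\<close>, leaving 1 over the product of all five.\<close>
  define c where "c i = 1 / (d (i + 3) * d i)" for i
  have c: "c i > 0" for i
    using pos(1)[of i] pos(1)[of "i + 3"] by (auto simp: c_def zero_less_mult_iff)
  define q where "q i = c i *\<^sub>R p i" for i
  define \<Delta> where "\<Delta> = 1 / (d 0 * d 1 * d 2 * d 3 * d 4)"
  have q: "det3 (q i) (q j) (q k) = c i * c j * c k * det3 (p i) (p j) (p k)" for i j k
    by (simp add: q_def det3_scale)
  have \<Delta>: "det3 (q i) (q (i + 1)) (q (i + 2)) = \<Delta>" for i
  proof -
    have "det3 (q i) (q (i + 1)) (q (i + 2)) = c i * c (i + 1) * c (i + 2) * d i"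
      by (simp add: q d_def)
    also have "\<dots> = 1 / (d i * d (i + 1) * d (i + 2) * d (i + 3) * d (i + 4))"
      using d0 by (simp add: c_def add.assoc mult_ac)
    also have "\<dots> = \<Delta>"
      using exhaust_5[of i] by (auto simp: \<Delta>_def mult_ac)
    finally show ?thesis .
  qed
  have "\<Delta> \<noteq> 0" using d0 by (simp add: \<Delta>_def)
  have "0 < \<sigma> * \<Delta>"
  proof -
    have "0 < (c 0 * c 1 * c 2) * (\<sigma> * d 0)" by (intro mult_pos_pos c pos)
    then show ?thesis using \<Delta>[of 0] q[of 0 1 2] by (simp add: d_def mult_ac)
  qed
  have ratio: "0 < det3 (q i) (q (i + 1)) (q (i + 3)) / \<Delta>" for i
  proof -
    have "0 < \<sigma> * det3 (q i) (q (i + 1)) (q (i + 3))"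
    proof -
      have "0 < (c i * c (i + 1) * c (i + 3)) * (\<sigma> * det3 (p i) (p (i + 1)) (p (i + 3)))"
        by (intro mult_pos_pos c pos)
      then show ?thesis by (simp add: q mult_ac)
    qed
    with \<open>0 < \<sigma> * \<Delta>\<close> show ?thesis by (auto simp: zero_less_mult_iff zero_less_divide_iff)
  qed
  define u where "u = det3 (q 2) (q 3) (q 0) / \<Delta>"
  define v where "v = det3 (q 0) (q 1) (q 3) / \<Delta>"
  define r where "r = det3 (q 1) (q 2) (q 4) / \<Delta>"
  define s where "s = det3 (q 4) (q 0) (q 2) / \<Delta>"
  have "u > 0" "v > 0"
    using ratio[of 2] ratio[of 0] by (simp_all add: u_def v_def)
  have D: "det3 (q 0) (q 1) (q 2) = \<Delta>" "det3 (q 1) (q 2) (q 3) = \<Delta>" "det3 (q 2) (q 3) (q 4) = \<Delta>"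
    "det3 (q 3) (q 4) (q 0) = \<Delta>" "det3 (q 4) (q 0) (q 1) = \<Delta>"
    using \<Delta>[of 0] \<Delta>[of 1] \<Delta>[of 2] \<Delta>[of 3] \<Delta>[of 4] by simp_all
  have comb: "x = (det3 x (q 1) (q 2) / \<Delta>) *\<^sub>R q 0 + (det3 (q 0) x (q 2) / \<Delta>) *\<^sub>R q 1
      + (det3 (q 0) (q 1) x / \<Delta>) *\<^sub>R q 2" for x
  proof -
    have "x = (1 / \<Delta>) *\<^sub>R (\<Delta> *\<^sub>R x)" using \<open>\<Delta> \<noteq> 0\<close> by simp
    also have "\<Delta> *\<^sub>R x = det3 x (q 1) (q 2) *\<^sub>R q 0 + det3 (q 0) x (q 2) *\<^sub>R q 1 + det3 (q 0) (q 1)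
        x *\<^sub>R q 2"
      using cramer3[of "q 0" "q 1" "q 2" x] by (simp add: D)
    finally show ?thesis by (simp add: scaleR_right_distrib)
  qed
  have perm: "det3 (q 3) (q 1) (q 2) = det3 (q 1) (q 2) (q 3)" "det3 (q 0) (q 3) (q 2) = - det3 (q
      2) (q 3) (q 0)"
    "det3 (q 4) (q 1) (q 2) = det3 (q 1) (q 2) (q 4)" "det3 (q 0) (q 4) (q 2) = - det3 (q 4) (q 0) (q 2)"
    "det3 (q 0) (q 1) (q 4) = det3 (q 4) (q 0) (q 1)"
    by (simp_all add: det3_expand)
  have q3: "q 3 = 1 *\<^sub>R q 0 + (- u) *\<^sub>R q 1 + v *\<^sub>R q 2"
    using comb[of "q 3"] \<open>\<Delta> \<noteq> 0\<close> unfolding perm D by (simp add: u_def v_def)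
  have q4: "q 4 = r *\<^sub>R q 0 + (- s) *\<^sub>R q 1 + 1 *\<^sub>R q 2"
    using comb[of "q 4"] \<open>\<Delta> \<noteq> 0\<close> unfolding perm D by (simp add: r_def s_def)
  \<comment> \<open>This determinant and the next must also equal \<open>\<Delta>\<close>, which
    gives the frieze relations \<open>v * s = 1 + u\<close> and
    \<open>u * r = 1 + s\<close>.\<close>
  have "det3 (q 3) (q 4) (q 0) = (v * s - u) * \<Delta>"
    using det3_lincomb[of 1 "q 0" "- u" "q 1" v "q 2" r "- s" 1 1 0 0] by (simp add: q3 q4 D)
  then have vs: "v * s = 1 + u" using D \<open>\<Delta> \<noteq> 0\<close> by simp
  have "det3 (q 2) (q 3) (q 4) = (u * r - s) * \<Delta>"
    using det3_lincomb[of 0 "q 0" 0 "q 1" 1 "q 2" 1 "- u" v r "- s" 1] by (simp add: q3 q4 D)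
  then have "u * r = 1 + s" using D \<open>\<Delta> \<noteq> 0\<close> by simp
  then have "u * v * r = v + v * s" by (metis mult.assoc mult.commute mult.left_commute
      mult.right_neutral distrib_left)
  then have r: "r = (1 + u + v) / (u * v)"
    using vs \<open>u > 0\<close> \<open>v > 0\<close> by (simp add: field_simps)
  have s: "s = (1 + u) / v"
    using vs \<open>v > 0\<close> by (simp add: field_simps)
  show ?thesis
  proof (rule that[of c u v, folded q_def])
    show "det3 (q 0) (q 1) (q 2) \<noteq> 0" using D(1) \<open>\<Delta> \<noteq> 0\<close> by simp
    show "q 3 = q 0 + (- u) *\<^sub>R q 1 + v *\<^sub>R q 2" using q3 by simp
    show "q 4 = ((1 + u + v) / (u * v)) *\<^sub>R q 0 + (- ((1 + u) / v)) *\<^sub>R q 1 + 1 *\<^sub>R q 2"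
      using q4 unfolding r s .
  qed fact+
qed

section \<open>The characteristic equation\<close>

lemma kernel_iff_det3_zero:
  assumes "linear f" "det3 a b c \<noteq> 0"
  shows "(\<exists>x. x \<noteq> 0 \<and> f x = 0) \<longleftrightarrow> det3 (f a) (f b) (f c) = 0"
proof -
  have "(\<exists>x. x \<noteq> 0 \<and> matrix f *v x = 0) \<longleftrightarrow> det (matrix f) = 0"
    by (metis invertible_det_nz invertible_left_inverse matrix_left_invertible_ker)
  then show ?thesis
    using assms matrix_vector_mul(2)[OF assms(1), THEN fun_cong] by (simp add: det3_linear)
qed

text \<open>In the basis \<open>q 0\<close>, \<open>q 1\<close>, \<open>q 2\<close> the determinant
  of the operator minus \<open>l\<close> is \<open>Y * (l + 1) - l^2 * (l - 1)\<close> times that of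
  the basis; \<open>u\<close> and \<open>v\<close> survive only in the product \<open>Y\<close> of
  the five frieze entries.\<close>

lemma eigenvalues_shifted_glick_frieze:
  assumes "u > 0" "v > 0" and det: "det3 (q 0) (q 1) (q 2) \<noteq> 0"
    and q3: "q 3 = q 0 + (- u) *\<^sub>R q 1 + v *\<^sub>R q 2"
    and q4: "q 4 = ((1 + u + v) / (u * v)) *\<^sub>R q 0 + (- ((1 + u) / v)) *\<^sub>R q 1 + 1 *\<^sub>R q 2"
  shows "l \<in> eigenvalues (shifted_glick q) \<longleftrightarrow>
    l\<^sup>2 * (l - 1) = (1 + u) * (1 + v) * (1 + u + v) / (u * v) * (l + 1)"
proof -
  define r where "r = (1 + u + v) / (u * v)"
  define s where "s = (1 + u) / v"
  define \<Delta> where "\<Delta> = det3 (q 0) (q 1) (q 2)"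
  have q3': "q 3 = 1 *\<^sub>R q 0 + (- u) *\<^sub>R q 1 + v *\<^sub>R q 2"
    and q4': "q 4 = r *\<^sub>R q 0 + (- s) *\<^sub>R q 1 + 1 *\<^sub>R q 2"
    and q0: "q 0 = 1 *\<^sub>R q 0 + 0 *\<^sub>R q 1 + 0 *\<^sub>R q 2"
    and q1: "q 1 = 0 *\<^sub>R q 0 + 1 *\<^sub>R q 1 + 0 *\<^sub>R q 2"
    and q2: "q 2 = 0 *\<^sub>R q 0 + 0 *\<^sub>R q 1 + 1 *\<^sub>R q 2"
    using q3 q4 by (simp_all add: r_def s_def)
  have vs: "v * s = 1 + u" and ur: "u * r = 1 + s"
    using assms(1,2) by (simp_all add: r_def s_def field_simps)
  note lc = det3_lincomb[of _ "q 0" _ "q 1" _ "q 2", folded \<Delta>_def]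
  have "det3 (q 2) (q 3) (q 4) = (u * r - s) * \<Delta>" "det3 (q 3) (q 4) (q 0) = (v * s - u) * \<Delta>"
    using lc[of 0 0 1 1 "- u" v r "- s" 1] lc[of 1 "- u" v r "- s" 1 1 0 0]
    by (simp_all add: q3' q4' \<Delta>_def algebra_simps)
  then have D34: "det3 (q 2) (q 3) (q 4) = \<Delta>" "det3 (q 3) (q 4) (q 0) = \<Delta>"
    using vs ur by simp_all
  have D: "det3 (q 0) (q 1) (q 2) = \<Delta>" "det3 (q 1) (q 2) (q 3) = \<Delta>" "det3 (q 4) (q 0) (q 1) = \<Delta>"
    "det3 (q 0) (q 1) (q 3) = v * \<Delta>" "det3 (q 1) (q 2) (q 4) = r * \<Delta>" "det3 (q 2) (q 3) (q 0) = u * \<Delta>"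
    "det3 (q 0) (q 2) (q 4) = s * \<Delta>" "det3 (q 1) (q 3) (q 0) = v * \<Delta>" "det3 (q 2) (q 4) (q 1) = r * \<Delta>"
    using lc[of 0 1 0 0 0 1 1 "- u" v]


      lc[of r "- s" 1 1 0 0 0 1 0]
      lc[of 1 0 0 0 1 0 1 "- u" v]
      lc[of 0 1 0 0 0 1 r "- s" 1]
      lc[of 0 0 1 1 "- u" v 1 0 0]
      lc[of 1 0 0 0 0 1 r "- s" 1]
      lc[of 0 1 0 1 "- u" v 1 0 0]
      lc[of 0 0 1 r "- s" 1 0 1 0]
    by (simp_all add: q3' q4' \<Delta>_def algebra_simps)
  have "\<Delta> \<noteq> 0" using det by (simp add: \<Delta>_def)
  have nz: "det3 (q i) (q (i + 1)) (q (i + 2)) \<noteq> 0" for i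
    using exhaust_5[of i] D D34 \<open>\<Delta> \<noteq> 0\<close> by auto
  let ?G = "shifted_glick q"
  have G: "?G (q 0) = q 0 + v *\<^sub>R q 2 + s *\<^sub>R q 3"
       "?G (q 1) = q 1 + r *\<^sub>R q 3 + v *\<^sub>R q 4"
       "?G (q 2) = q 2 + u *\<^sub>R q 4 + r *\<^sub>R q 0"
    using shifted_glick_vertex[of q 0, OF nz] shifted_glick_vertex[of q 1, OF nz]
        shifted_glick_vertex[of q 2, OF nz] D D34 \<open>\<Delta> \<noteq> 0\<close>
    by simp_all
  have e: "?G (q 0) - l *\<^sub>R q 0 = (1 + s - l) *\<^sub>R q 0 + (- (s * u)) *\<^sub>R q 1 + (v + s * v) *\<^sub>R q 2"
    "?G (q 1) - l *\<^sub>R q 1 = (r + v * r) *\<^sub>R q 0 + (1 - r * u - v * s - l) *\<^sub>R q 1 + (r * v + v) *\<^sub>R q 2"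
    "?G (q 2) - l *\<^sub>R q 2 = (u * r + r) *\<^sub>R q 0 + (- (u * s)) *\<^sub>R q 1 + (1 + u - l) *\<^sub>R q 2"
    unfolding G q3' q4' by (simp_all add: algebra_simps)
  define Y where "Y = (1 + u) * (1 + v) * (1 + u + v) / (u * v)"
  have "l \<in> eigenvalues ?G \<longleftrightarrow> (\<exists>x. x \<noteq> 0 \<and> ?G x - l *\<^sub>R x = 0)"
    by (auto simp: eigenvalues_def eigenvector_for_def)
  also have "\<dots> \<longleftrightarrow> det3 (?G (q 0) - l *\<^sub>R q 0) (?G (q 1) - l *\<^sub>R q 1) (?G (q 2) - l *\<^sub>R q 2) = 0"
    by (intro kernel_iff_det3_zero det linear_compose_sub linear_shifted_glick linear_scale_self)
  also have "\<dots> \<longleftrightarrow> l\<^sup>2 * (l - 1) = Y * (l + 1)"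
  proof -
    have "det3 (?G (q 0) - l *\<^sub>R q 0) (?G (q 1) - l *\<^sub>R q 1) (?G (q 2) - l *\<^sub>R q 2)
      = (Y * (l + 1) - l\<^sup>2 * (l - 1)) * \<Delta>"
      unfolding e lc Y_def r_def s_def using assms(1,2)
      by (simp add: field_simps power2_eq_square)
    then show ?thesis using \<open>\<Delta> \<noteq> 0\<close> by auto
  qed
  finally show ?thesis by (simp add: Y_def)
qed

section \<open>The spectrum\<close>

text \<open>Vieta's formula for \<open>x^3 - x^2 - Y * x - Y\<close>, by divided differences. It
  serves to show both that the positive root dominates and that there is no fourth root.\<close>

lemma roots_sum:
  fixes a b c Y :: real
  assumes "a\<^sup>2 * (a - 1) = Y * (a + 1)" "b\<^sup>2 * (b - 1) = Y * (b + 1)" "c\<^sup>2 * (c - 1) = Y * (c + 1)"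
    and "a \<noteq> b" "a \<noteq> c" "b \<noteq> c"
  shows "a + b + c = 1"
proof -
  have *: "x\<^sup>2 + x * y + y\<^sup>2 - (x + y) = Y"
    if "x\<^sup>2 * (x - 1) = Y * (x + 1)" "y\<^sup>2 * (y - 1) = Y * (y + 1)" "x \<noteq> y" for x y
  proof -
    have "(x - y) * (x\<^sup>2 + x * y + y\<^sup>2 - (x + y)) = x\<^sup>2 * (x - 1) - y\<^sup>2 * (y - 1)"
      by (simp add: power2_eq_square algebra_simps)
    also have "\<dots> = (x - y) * Y"
      using that by (simp add: algebra_simps)
    finally show ?thesis using that(3) by simp
  qed
  have "(b - c) * (a + b + c - 1) = (a\<^sup>2 + a * b + b\<^sup>2 - (a + b)) - (a\<^sup>2 + a * c + c\<^sup>2 - (a + c))"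
    by (simp add: power2_eq_square algebra_simps)
  also have "\<dots> = 0"
    using * assms by simp
  finally show ?thesis using assms(6) by simp
qed

text \<open>
  Here \<open>g\<close> is the golden ratio and \<open>5 * g + 3\<close> is its fifth power; the cubic changes sign at
  \<open>- g\<close> exactly when \<open>Y\<close> passes that value.
\<close>

lemma cubic_roots:
  fixes g Y :: real
  assumes g: "g > 0" "g\<^sup>2 = g + 1" and Y: "Y > 5 * g + 3"
  obtains l1 l2 l3 where "l1 > 0" "\<bar>l1\<bar> > \<bar>l2\<bar>" "\<bar>l2\<bar> > \<bar>l3\<bar>" "l3 \<noteq> 0"
    "\<And>x. x\<^sup>2 * (x - 1) = Y * (x + 1) \<longleftrightarrow> x \<in> {l1, l2, l3}"
proof -
  define f where "f x = x\<^sup>2 * (x - 1) - Y * (x + 1)" for x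
  have cont: "continuous_on S f" for S
    unfolding f_def by (intro continuous_intros)
  have "g > 1"
  proof (rule ccontr)
    assume "\<not> g > 1"
    then have "g * g \<le> g * 1" using g(1) by (intro mult_left_mono) auto
    with g show False by (simp add: power2_eq_square)
  qed
  \<comment> \<open>Multiplying by \<open>g\<close> turns \<open>Y * (g - 1)\<close> into
    \<open>Y\<close>, since \<open>g * (g - 1) = 1\<close>.\<close>
  have "g * f (- g) > 0"
  proof -
    have "g * (g - 1) = 1" using g by (simp add: power2_eq_square algebra_simps)
    have g3: "g ^ 3 = 2 * g + 1" using g by (simp add: power3_eq_cube power2_eq_square algebra_simps)
    have "g * f (- g) = - (g ^ 3 * (g + 1)) + Y * (g * (g - 1))"
      by (simp add: f_def power2_eq_square power3_eq_cube algebra_simps)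
    also have "\<dots> = Y - (5 * g + 3)"
      using g \<open>g * (g - 1) = 1\<close> by (simp add: g3 power2_eq_square algebra_simps)
    finally show ?thesis using Y by simp
  qed
  then have fg: "f (- g) > 0" using g(1) by (simp add: zero_less_mult_iff)
  \<comment> \<open>The signs -, +, -, -, + at \<open>- (Y + g)\<close>, \<open>- g\<close>,
    \<open>- 1\<close>, \<open>0\<close>, \<open>Y + 2\<close> isolate three roots, with
    \<open>- g\<close> between the two negative ones.\<close>
  have "f (- (Y + g)) < 0"
  proof -
    define x where "x = Y + g"
    have x: "x > Y" "x > 1" using Y \<open>g > 1\<close> by (auto simp: x_def)
    have "Y * (x - 1) \<le> x * (x - 1)" using x by (intro mult_right_mono) auto
    also have "\<dots> < (x * x) * (x + 1)"
    proof -
      have "0 < x + x * (x * x)" using x by (intro add_pos_pos mult_pos_pos) auto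
      then show ?thesis by (simp add: algebra_simps)
    qed
    finally have "f (- x) < 0" by (simp add: f_def power2_eq_square algebra_simps)
    then show ?thesis by (simp add: x_def)
  qed
  then obtain l2 where l2: "- (Y + g) \<le> l2" "l2 \<le> - g" "f l2 = 0"
    using IVT'[of f "- (Y + g)" 0 "- g"] fg cont Y g by auto
  have "f (- 1) < 0" by (simp add: f_def)
  then obtain l3 where l3: "- g \<le> l3" "l3 \<le> - 1" "f l3 = 0"
    using IVT2'[of f "- 1" 0 "- g"] fg cont \<open>g > 1\<close> by auto
  have "f 0 < 0" using Y g(1) by (simp add: f_def)
  moreover have "f (Y + 2) > 0"
  proof -
    have "Y > 0" using Y g(1) by simp
    have "f (Y + 2) = Y ^ 3 + 4 * Y\<^sup>2 + 5 * Y + 4"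
      by (simp add: f_def power2_eq_square power3_eq_cube algebra_simps)
    then show ?thesis using \<open>Y > 0\<close> by (simp add: add_pos_pos)
  qed
  ultimately obtain l1 where l1: "0 \<le> l1" "f l1 = 0"
    using IVT'[of f 0 0 "Y + 2"] cont Y g(1) by auto
  have lt: "l1 > 0" "l2 < - g" "- g < l3" "l3 < 0"
    using l1 l2 l3 \<open>f 0 < 0\<close> fg by (auto simp: less_le)
  have root: "f x = 0 \<longleftrightarrow> x\<^sup>2 * (x - 1) = Y * (x + 1)" for x by (auto simp: f_def)
  have sum: "l1 + l2 + l3 = 1"
    using l1 l2 l3 lt by (intro roots_sum[of _ Y]) (auto simp: root)
  show ?thesis
  proof (rule that[of l1 l2 l3])
    \<comment> \<open>The roots sum to 1 and two are negative, so
      \<open>l1 = 1 + \<bar>l2\<bar> + \<bar>l3\<bar>\<close>.\<close>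
    show "l1 > 0" "\<bar>l2\<bar> < \<bar>l1\<bar>" "\<bar>l3\<bar> < \<bar>l2\<bar>" "l3 \<noteq> 0" using lt sum by auto
    fix x
    have "x = l3" if "f x = 0" "x \<noteq> l1" "x \<noteq> l2"
      using roots_sum[of l1 Y l2 x] sum that l1 l2 lt by (auto simp: root)
    then show "x\<^sup>2 * (x - 1) = Y * (x + 1) \<longleftrightarrow> x \<in> {l1, l2, l3}"
      using l1 l2 l3 by (auto simp flip: root)
  qed
qed

text \<open>With mean \<open>s\<close> and half-difference \<open>t\<close>, the inequality cleared
  of denominators splits into a part in \<open>s\<close> alone, with a double zero at
  \<open>s = g\<close>, and a multiple of \<open>t^2\<close>. That multiple loses its sign for large
  \<open>s\<close>, where a cruder identity suffices.\<close>

lemma frieze_product_bound: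
  fixes g u v :: real
  assumes g: "g > 0" "g\<^sup>2 = g + 1" and "u > 0" "v > 0" "\<not> (u = g \<and> v = g)"
  shows "(1 + u) * (1 + v) * (1 + u + v) / (u * v) > 5 * g + 3"
proof -
  have "g < 2"
  proof (rule ccontr)
    assume "\<not> g < 2"
    then have "2 * g \<le> g * g" using g(1) by (intro mult_right_mono) auto
    with g \<open>\<not> g < 2\<close> show False by (simp add: power2_eq_square)
  qed
  define s where "s = (u + v) / 2"
  define t where "t = (u - v) / 2"
  have uv: "u = s + t" "v = s - t" by (simp_all add: s_def t_def field_simps)
  have "s > 0" using assms by (simp add: s_def)
  have "(1 + u) * (1 + v) * (1 + u + v) - (5 * g + 3) * (u * v) > 0"
  proof (cases "2 * s \<ge> 5 * g + 2")
    case True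
    have "(1 + u) * (1 + v) * (1 + u + v) - (5 * g + 3) * (u * v) = (1 + 2 * s)\<^sup>2 + (u * v) * (2 * s
        - (5 * g + 2))"
      by (simp add: uv power2_eq_square algebra_simps)
    also have "\<dots> > 0"
      using True assms \<open>s > 0\<close> by (intro add_pos_nonneg mult_nonneg_nonneg) auto
    finally show ?thesis .
  next
    case False
    have gg: "g * (g * x) = x + g * x" for x
      using g by (metis distrib_right mult.assoc mult_1 power2_eq_square add.commute)
    have "(1 + u) * (1 + v) * (1 + u + v) - (5 * g + 3) * (u * v)
       = (s - g)\<^sup>2 * (2 * s + 2 - g) + t\<^sup>2 * (5 * g + 2 - 2 * s)"
      using g by (simp add: uv power2_eq_square algebra_simps gg)
    also have "\<dots> > 0"
    proof (cases "t = 0")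
      case True
      then have "s \<noteq> g" using assms(5) uv by auto
      then show ?thesis using \<open>s > 0\<close> \<open>g < 2\<close> True by simp
    next
      case nz: False
      then have "t\<^sup>2 * (5 * g + 2 - 2 * s) > 0" using False by simp
      moreover have "(s - g)\<^sup>2 * (2 * s + 2 - g) \<ge> 0" using \<open>s > 0\<close> \<open>g < 2\<close> by simp
      ultimately show ?thesis by simp
    qed
    finally show ?thesis .
  qed
  then show ?thesis using assms by (simp add: pos_less_divide_eq)
qed

section \<open>Comparison with the regular pentagon\<close>

lemma linear_map_on_basis:
  assumes "det3 a b c \<noteq> 0"
  obtains f where "linear f" "f a = a'" "f b = b'" "f c = c'"
proof -
  define f where "f x = (det3 x b c / det3 a b c) *\<^sub>R a' + (det3 a x c / det3 a b c) *\<^sub>R b'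
    + (det3 a b x / det3 a b c) *\<^sub>R c'" for x :: "real^3"
  have add: "det3 (x + y) b c = det3 x b c + det3 y b c" "det3 a (x + y) c = det3 a x c + det3 a y c"
    "det3 a b (x + y) = det3 a b x + det3 a b y"
    "det3 (r *\<^sub>R x) b c = r * det3 x b c" "det3 a (r *\<^sub>R x) c = r * det3 a x c" "det3 a b (r *\<^sub>R x)
        = r * det3 a b x"
    and zero: "det3 b b c = 0" "det3 c b c = 0" "det3 a a c = 0" "det3 a c c = 0" "det3 a b a = 0"
        "det3 a b b = 0"
    for x y r
    by (simp_all add: det3_expand algebra_simps)
  have "linear f"
    by (rule linearI) (simp_all add: f_def add add_divide_distrib algebra_simps)
  with assms that[of f] show ?thesis
    by (simp add: f_def zero)
qed

text \<open>For \<open>t = 2 * pi / 5\<close> the angles \<open>3 * t\<close> and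
  \<open>2 * t\<close> add up to a full turn, so their cosines agree; dividing out the root 1 leaves
  a quadratic equation for \<open>cos t\<close>, which says that \<open>g\<close> is the golden
  ratio.\<close>

lemma golden_cos:
  defines "g \<equiv> 1 + 2 * cos (2 * pi / 5)"
  shows "g > 0" "g\<^sup>2 = g + 1" "sin (2 * pi / 5) > 0"
proof -
  define t where "t = 2 * pi / 5"
  define c where "c = cos t"
  have t: "0 < t" "t < pi / 2" by (simp_all add: t_def)
  have "c > 0" using t by (simp add: c_def cos_gt_zero)
  have "c < 1" using t cos_monotone_0_pi[of 0 t] by (simp add: c_def)
  have "cos (3 * t) = cos (2 * t)"
    using cos_2pi_minus[of "2 * t"] by (simp add: t_def field_simps)
  then have "4 * c ^ 3 - 3 * c = 2 * c\<^sup>2 - 1"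
    unfolding c_def cos_treble_cos cos_double_cos .
  then have "(c - 1) * (4 * c\<^sup>2 + 2 * c - 1) = 0"
    by (simp add: power2_eq_square power3_eq_cube algebra_simps)
  then have "4 * c\<^sup>2 + 2 * c - 1 = 0" using \<open>c < 1\<close> by simp
  then show "g\<^sup>2 = g + 1" by (simp add: g_def c_def t_def power2_eq_square algebra_simps)
  show "g > 0" using \<open>c > 0\<close> by (simp add: g_def c_def t_def)
  show "sin (2 * pi / 5) > 0" using t by (intro sin_gt_zero) (auto simp: t_def)
qed

text \<open>By rotational symmetry the plain lifts have equal consecutive determinants, so they are
  already in frieze form, with all entries equal to \<open>g\<close>.\<close>

lemma regular_pentagon_exists:
  defines "g \<equiv> 1 + 2 * cos (2 * pi / 5)"
  obtains Q where "regular_pentagon Q" "det3 (lift (Q 0)) (lift (Q 1)) (lift (Q 2)) \<noteq> 0"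
    "lift (Q 3) = lift (Q 0) + (- g) *\<^sub>R lift (Q 1) + g *\<^sub>R lift (Q 2)"
    "lift (Q 4) = g *\<^sub>R lift (Q 0) + (- g) *\<^sub>R lift (Q 1) + lift (Q 2)"
proof -
  define t where "t = 2 * pi / 5"
  define c where "c = cos t"
  define s where "s = sin t"
  have s2: "s * s = 1 - c * c" by (simp add: c_def s_def flip: power2_eq_square) (simp add:
      sin_squared_eq)
  have g: "g = 1 + 2 * c" by (simp add: g_def c_def t_def)
  have c2: "4 * (c * c) = 1 - 2 * c" and "s > 0"
    using golden_cos by (simp_all add: c_def s_def t_def power2_eq_square algebra_simps)
  \<comment> \<open>The points of the unit circle at multiples of \<open>t\<close>; the last two are
    mirror images of earlier ones, which keeps all coordinates of low degree in \<open>c\<close> and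
    \<open>s\<close>.\<close>
  define Q :: pentagon where "Q i = (if i = 0 then vector [1, 0] else if i = 1 then vector [c, s]
    else if i = 2 then vector [2 * (c * c) - 1, 2 * (c * s)]
    else if i = 3 then vector [2 * (c * c) - 1, - 2 * (c * s)] else vector [c, - s])" for i
  have Q: "Q 0 = vector [1, 0]" "Q 1 = vector [c, s]" "Q 2 = vector [2 * (c * c) - 1, 2 * (c * s)]"
    "Q 3 = vector [2 * (c * c) - 1, - 2 * (c * s)]" "Q 4 = vector [c, - s]"
    by (simp_all add: Q_def)
  \<comment> \<open>The quadratic equation of \<open>c\<close> as rewrite rules, which lower every
    power of \<open>c\<close> and of \<open>s\<close> to degree at most one.\<close>
  have red: "c * c = 1 / 4 - c / 2" "s * s = 3 / 4 + c / 2"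
    using c2 s2 by auto
  have red': "c * (c * x) = x / 4 - c * x / 2" "s * (s * x) = 3 * x / 4 + c * x / 2" for x
  proof -
    have "c * (c * x) = (1 / 4 - c / 2) * x" "s * (s * x) = (3 / 4 + c / 2) * x"
      by (simp_all flip: red)
    then show "c * (c * x) = x / 4 - c * x / 2" "s * (s * x) = 3 * x / 4 + c * x / 2"
      by (simp_all add: algebra_simps)
  qed
  have R: "c * c - s * s = 2 * (c * c) - 1" "s * c + c * s = 2 * (c * s)"
    "c * (2 * (c * c) - 1) - s * (2 * (c * s)) = 2 * (c * c) - 1"
    "s * (2 * (c * c) - 1) + c * (2 * (c * s)) = - 2 * (c * s)"
    "c * (2 * (c * c) - 1) - s * (- 2 * (c * s)) = c"
    "s * (2 * (c * c) - 1) + c * (- 2 * (c * s)) = - s"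
    "c * c - s * - s = 1" "s * c + c * - s = 0"
    by (simp_all add: algebra_simps red red')
  have rot: "Q (i + 1) = 0 + rotate2 (2 * pi / 5) (Q i - 0)" for i
  proof -
    have rot: "rotate2 (2 * pi / 5) x = vector [c * x $ 1 - s * x $ 2, s * x $ 1 + c * x $ 2]" for x
      by (simp add: rotate2_def c_def s_def t_def)
    show ?thesis
      unfolding add_0 diff_zero rot
      using exhaust_5[of i]
    proof (elim disjE)
      assume "i = 0" then show "Q (i + 1) = vector [c * Q i $ 1 - s * Q i $ 2, s * Q i $ 1 + c * Q i
          $ 2]"
        by (simp add: Q)
    next
      assume "i = 1"
      then have "i + 1 = 2" "i = 1" by simp_all
      then show "Q (i + 1) = vector [c * Q i $ 1 - s * Q i $ 2, s * Q i $ 1 + c * Q i $ 2]"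
        by (simp only: Q vector_2 R)
    next
      assume "i = 2"
      then have "i + 1 = 3" "i = 2" by simp_all
      then show "Q (i + 1) = vector [c * Q i $ 1 - s * Q i $ 2, s * Q i $ 1 + c * Q i $ 2]"
        by (simp only: Q vector_2 R)
    next
      assume "i = 3"
      then have "i + 1 = 4" "i = 3" by simp_all
      then show "Q (i + 1) = vector [c * Q i $ 1 - s * Q i $ 2, s * Q i $ 1 + c * Q i $ 2]"
        by (simp only: Q vector_2 R)
    next
      assume "i = 4"
      then have "i + 1 = 0" "i = 4" by simp_all
      then show "Q (i + 1) = vector [c * Q i $ 1 - s * Q i $ 2, s * Q i $ 1 + c * Q i $ 2]"
        by (simp only: Q vector_2 R)
    qed
  qed
  have L: "2 * (c * c) - 1 = 1 - g * c + g * (2 * (c * c) - 1)"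
    "- 2 * (c * s) = - (g * s) + g * (2 * (c * s))"
    "c = g - g * c + (2 * (c * c) - 1)" "- s = - (g * s) + 2 * (c * s)"
    unfolding g by (simp_all add: algebra_simps red red')
  show ?thesis
  proof (rule that[of Q])
    show "regular_pentagon Q"
      unfolding regular_pentagon_def
    proof (intro exI bexI conjI allI)
      show "Q 0 \<noteq> 0" by (simp add: Q vec_eq_iff forall_2)
      show "Q (i + 1) = 0 + rotate2 (2 * pi / 5) (Q i - 0)" for i by (rule rot)
    qed simp
    have "det3 (lift (Q 0)) (lift (Q 1)) (lift (Q 2)) = 2 * (s * (1 - c))"
      by (simp add: det3_expand Q algebra_simps)
    moreover have "c \<noteq> 1" using c2 by auto
    ultimately show "det3 (lift (Q 0)) (lift (Q 1)) (lift (Q 2)) \<noteq> 0" using \<open>s > 0\<close> by simp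
    show "lift (Q 3) = lift (Q 0) + (- g) *\<^sub>R lift (Q 1) + g *\<^sub>R lift (Q 2)"
      using L(1,2) by (simp add: vec_eq_iff forall_3 Q)
    show "lift (Q 4) = g *\<^sub>R lift (Q 0) + (- g) *\<^sub>R lift (Q 1) + lift (Q 2)"
      using L(3,4) by (simp add: vec_eq_iff forall_3 Q)
  qed
qed

lemma shifted_glick_spectrum:
  assumes conv: "convex_lifts \<sigma> (\<lambda>i. lift (P i))"
    and nreg: "\<not> (\<exists>Q. regular_pentagon Q \<and> projectively_equivalent P Q)"
  obtains l1 l2 l3 where "l1 > 0" "l3 \<noteq> 0"
    "ordered_eigenvalues (shifted_glick (\<lambda>i. lift (P i))) l1 l2 l3"
proof -
  obtain c :: "5 \<Rightarrow> real" and u v where c: "\<And>i. c i > 0" and uv: "u > 0" "v > 0" and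
    q: "det3 (c 0 *\<^sub>R lift (P 0)) (c 1 *\<^sub>R lift (P 1)) (c 2 *\<^sub>R lift (P 2)) \<noteq> 0"
    "c 3 *\<^sub>R lift (P 3) = c 0 *\<^sub>R lift (P 0) + (- u) *\<^sub>R (c 1 *\<^sub>R lift (P 1)) + v *\<^sub>R (c 2 *\<^sub>R lift
        (P 2))"
    "c 4 *\<^sub>R lift (P 4) = ((1 + u + v) / (u * v)) *\<^sub>R (c 0 *\<^sub>R lift (P 0)) + (- ((1 + u) / v)) *\<^sub>R
        (c 1 *\<^sub>R lift (P 1)) + 1 *\<^sub>R (c 2 *\<^sub>R lift (P 2))"
    using frieze_form[OF conv] by metis
  define g where "g = 1 + 2 * cos (2 * pi / 5)"
  note g = golden_cos(1,2)[folded g_def]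
  define Y where "Y = (1 + u) * (1 + v) * (1 + u + v) / (u * v)"
  \<comment> \<open>Equal parameters mean equal normal forms: the linear map matching the first
    three normalized lifts with those of a regular pentagon matches all five.\<close>
  have "\<not> (u = g \<and> v = g)"
  proof
    assume eq: "u = g \<and> v = g"
    have g1: "(1 + g + g) / (g * g) = g" "(1 + g) / g = g"
      using g by (simp_all add: field_simps power2_eq_square)
    obtain Q where Q: "regular_pentagon Q" "det3 (lift (Q 0)) (lift (Q 1)) (lift (Q 2)) \<noteq> 0"
      "lift (Q 3) = lift (Q 0) + (- g) *\<^sub>R lift (Q 1) + g *\<^sub>R lift (Q 2)"
      "lift (Q 4) = g *\<^sub>R lift (Q 0) + (- g) *\<^sub>R lift (Q 1) + lift (Q 2)"
      using regular_pentagon_exists unfolding g_def by metis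
    obtain f where f: "linear f" "f (c 0 *\<^sub>R lift (P 0)) = lift (Q 0)" "f (c 1 *\<^sub>R lift (P 1)) =
        lift (Q 1)"
      "f (c 2 *\<^sub>R lift (P 2)) = lift (Q 2)"
      using linear_map_on_basis[OF q(1)] by metis
    have lin: "f (r *\<^sub>R x + s *\<^sub>R y + t *\<^sub>R z) = r *\<^sub>R f x + s *\<^sub>R f y + t *\<^sub>R f z" for r s t x y z
      by (simp add: linear_add[OF f(1)] linear_cmul[OF f(1)])
    have "f (c 3 *\<^sub>R lift (P 3)) = lift (Q 3)"
      using lin[of 1 _ "- u" _ v] eq unfolding q(2) Q(3) by (simp only: f(2-4) scaleR_one)
    moreover have "f (c 4 *\<^sub>R lift (P 4)) = lift (Q 4)"
      unfolding q(3) Q(4) lin f(2-4) using eq by (simp only: g1 scaleR_one)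
    ultimately have fQ: "f (c i *\<^sub>R lift (P i)) = lift (Q i)" for i
      using exhaust_5[of i] f by auto
    have "det (matrix f) \<noteq> 0"
      using det3_linear[OF f(1), of "c 0 *\<^sub>R lift (P 0)" "c 1 *\<^sub>R lift (P 1)" "c 2 *\<^sub>R lift (P 2)"] Q(2)
      by (auto simp: fQ)
    then have "projectively_equivalent P Q"
      unfolding projectively_equivalent_def
    proof (intro exI[of _ "matrix f"] conjI allI)
      fix i
      have "f (lift (P i)) = (1 / c i) *\<^sub>R lift (Q i)"
        using c[of i] by (simp add: linear_cmul[OF f(1)] flip: fQ)
      then show "\<exists>d. d \<noteq> 0 \<and> matrix f *v lift (P i) = d *\<^sub>R lift (Q i)"
        using c[of i] matrix_vector_mul(2)[OF f(1), THEN fun_cong, of "lift (P i)"]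
        by (intro exI[of _ "1 / c i"]) simp
    qed (simp add: invertible_det_nz)
    with Q(1) nreg show False by blast
  qed
  then have "Y > 5 * g + 3"
    unfolding Y_def by (intro frieze_product_bound g uv)
  then obtain l1 l2 l3 where l: "l1 > 0" "\<bar>l1\<bar> > \<bar>l2\<bar>" "\<bar>l2\<bar> > \<bar>l3\<bar>" "l3 \<noteq> 0"
    "\<And>x. x\<^sup>2 * (x - 1) = Y * (x + 1) \<longleftrightarrow> x \<in> {l1, l2, l3}"
    using cubic_roots[OF g] by metis
  have "shifted_glick (\<lambda>i. lift (P i)) = shifted_glick (\<lambda>i. c i *\<^sub>R lift (P i))"
    using shifted_glick_scale[of c] c by (auto simp: fun_eq_iff less_imp_neq[symmetric])
  then have "x \<in> eigenvalues (shifted_glick (\<lambda>i. lift (P i))) \<longleftrightarrow> x \<in> {l1, l2, l3}" for x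
    using eigenvalues_shifted_glick_frieze[OF uv, of "\<lambda>i. c i *\<^sub>R lift (P i)", OF q, of x] l(5)[of
        x, unfolded Y_def]
    by (simp only: )
  then have "eigenvalues (shifted_glick (\<lambda>i. lift (P i))) = {l1, l2, l3}" by blast
  with l that show ?thesis by (simp add: ordered_eigenvalues_def)
qed

section \<open>Iterating the pentagram map\<close>

lemma mem_affine_hull_pair_iff:
  fixes a b x :: "real^2"
  assumes "a \<noteq> b"
  shows "x \<in> affine hull {a, b} \<longleftrightarrow> det3 (lift a) (lift b) (lift x) = 0"
proof
  assume "x \<in> affine hull {a, b}"
  then obtain u v where "x = u *\<^sub>R a + v *\<^sub>R b" "u + v = 1"
    by (auto simp: affine_hull_2)
  then have x: "x = (1 - v) *\<^sub>R a + v *\<^sub>R b" by (simp add: eq_diff_eq[symmetric])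
  show "det3 (lift a) (lift b) (lift x) = 0"
    unfolding x by (simp add: det3_expand algebra_simps)
next
  assume "det3 (lift a) (lift b) (lift x) = 0"
  then obtain r s t where nz: "(r, s, t) \<noteq> (0, 0, 0)" and eq: "r *\<^sub>R lift a + s *\<^sub>R lift b + t *\<^sub>R
      lift x = 0"
    using det3_zero_imp_dependent by blast
  have sum: "r + s + t = 0" using arg_cong[OF eq, of "\<lambda>v. v $ 3"] by simp
  have eq2: "r *\<^sub>R a + s *\<^sub>R b + t *\<^sub>R x = 0"
    using arg_cong[OF eq, of "\<lambda>v. v $ 1"] arg_cong[OF eq, of "\<lambda>v. v $ 2"]
    by (simp add: vec_eq_iff forall_2)
  have "t \<noteq> 0"
  proof
    assume "t = 0"
    with sum have "s = - r" by simp
    with eq2 \<open>t = 0\<close> have "r *\<^sub>R (a - b) = 0" by (simp add: algebra_simps)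
    with nz \<open>t = 0\<close> \<open>s = - r\<close> assms show False by simp
  qed
  have "x = (- r / t) *\<^sub>R a + (- s / t) *\<^sub>R b"
  proof -
    have "t *\<^sub>R x = - r *\<^sub>R a - s *\<^sub>R b" using eq2 by (simp add: algebra_simps eq_neg_iff_add_eq_0)
    then have "x = (1 / t) *\<^sub>R (- r *\<^sub>R a - s *\<^sub>R b)"
      using \<open>t \<noteq> 0\<close> by (metis divide_self scaleR_one scaleR_scaleR times_divide_eq_left mult_1)
    then show ?thesis by (simp add: scaleR_diff_right)
  qed
  moreover have "- r / t + - s / t = 1" using sum \<open>t \<noteq> 0\<close> by (simp add: field_simps)
  ultimately show "x \<in> affine hull {a, b}"
    unfolding affine_hull_2 by blast
qed

lemma cramer2: "det2 a b *\<^sub>R v = det2 v b *\<^sub>R a + det2 a v *\<^sub>R b"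
  by (simp add: vec_eq_iff forall_2 det2_expand algebra_simps)

lemma convex_lifts_nonzero:
  assumes "convex_lifts \<sigma> p"
  shows "det3 (p i) (p (i + 1)) (p (i + 2)) \<noteq> 0" "det3 (p i) (p (i + 1)) (p (i + 3)) \<noteq> 0"
  using assms unfolding convex_lifts_def by (metis less_irrefl mult_zero_right)+

lemma convex_lifts_diagonal:
  assumes "convex_lifts \<sigma> (\<lambda>i. lift (P i))"
  shows "P i \<noteq> P (i + 2)"
  using convex_lifts_nonzero(1)[OF assms, of i] by (auto simp: det3_expand)

lemma pentagram_eqI:
  assumes conv: "convex_lifts \<sigma> (\<lambda>i. lift (P i))"
    and x: "det3 (lift (P i)) (lift (P (i + 2))) (lift x) = 0"
      "det3 (lift (P (i + 1))) (lift (P (i + 3))) (lift x) = 0"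
  shows "pentagram P i = x"
  unfolding pentagram_def
proof (rule the_equality)
  let ?p = "\<lambda>j. lift (P (i + j))"
  have idx: "i + 1 + 2 = i + 3" "i + 2 + 1 = i + 3" "i + 2 + 3 = i" by simp_all
  have ne: "P i \<noteq> P (i + 2)" "P (i + 1) \<noteq> P (i + 3)"
    using convex_lifts_diagonal[OF conv, of i] convex_lifts_diagonal[OF conv, of "i + 1"] by
        (simp_all add: idx)
  note mem = ne[THEN mem_affine_hull_pair_iff]
  show "x \<in> affine hull {P i, P (i + 2)} \<inter> affine hull {P (i + 1), P (i + 3)}"
    using x mem by simp
  fix y assume "y \<in> affine hull {P i, P (i + 2)} \<inter> affine hull {P (i + 1), P (i + 3)}"
  with mem have y: "det3 (lift (P i)) (lift (P (i + 2))) (lift y) = 0"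
      "det3 (lift (P (i + 1))) (lift (P (i + 3))) (lift y) = 0"
    by simp_all
  define e where "e = P (i + 2) - P i"
  define f where "f = P (i + 3) - P (i + 1)"
  have "det2 e (y - x) = 0" "det2 f (y - x) = 0"
    using x y by (simp_all add: det3_expand det2_expand e_def f_def algebra_simps)
  moreover have "det2 e f \<noteq> 0"
  proof -
    \<comment> \<open>Twice the signed area of the quadrilateral with diagonals \<open>e\<close> and
      \<open>f\<close>, cut into two triangles of the same orientation; hence the diagonals are not
      parallel.\<close>
    have "det2 e f = det3 (?p 2) (?p 3) (lift (P i)) + det3 (lift (P i)) (?p 1) (?p 2)"
      by (simp add: det3_expand det2_expand e_def f_def algebra_simps)
    moreover have "0 < \<sigma> * det3 (?p 2) (?p 3) (lift (P i))" "0 < \<sigma> * det3 (lift (P i)) (?p 1) (?p 2)"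
      using conv[unfolded convex_lifts_def, THEN spec, of "i + 2"] conv[unfolded convex_lifts_def,
          THEN spec, of i]
      by (simp_all add: idx)
    ultimately have "0 < \<sigma> * det2 e f" by (simp add: distrib_left)
    then show ?thesis by (metis less_irrefl mult_zero_right)
  qed
  moreover have "det2 (y - x) f = - det2 f (y - x)" by (simp add: det2_expand)
  ultimately have "det2 e f *\<^sub>R (y - x) = 0"
    by (simp add: cramer2[of e f "y - x"])
  with \<open>det2 e f \<noteq> 0\<close> show "y = x" by simp
qed

text \<open>The coefficient of \<open>p (i + 2)\<close> is the one that makes the determinant with
  \<open>p (i + 1)\<close> and \<open>p (i + 3)\<close> cancel, and likewise
  \<open>p (i + 3)\<close> for the other diagonal.\<close>

lemma shifted_glick_vertex_on_diagonals:
  assumes "\<And>i. det3 (p i) (p (i + 1)) (p (i + 2)) \<noteq> 0"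
  shows "det3 (p (i + 1)) (p (i + 3)) (shifted_glick p (p i)) = 0"
    "det3 (p (i + 2)) (p (i + 4)) (shifted_glick p (p i)) = 0"
proof -
  have lin: "det3 x y (v + r *\<^sub>R z + s *\<^sub>R w) = det3 x y v + r * det3 x y z + s * det3 x y w" for x
      y v z w r s
    by (simp add: det3_expand algebra_simps)
  have nz: "det3 (p (i + 1)) (p (i + 2)) (p (i + 3)) \<noteq> 0" "det3 (p (i + 2)) (p (i + 3)) (p (i + 4)) \<noteq> 0"
    using assms[of "i + 1"] assms[of "i + 2"] by (simp_all add: add.assoc)
  have perm: "det3 (p (i + 1)) (p (i + 3)) (p i) = det3 (p i) (p (i + 1)) (p (i + 3))"
    "det3 (p (i + 1)) (p (i + 3)) (p (i + 2)) = - det3 (p (i + 1)) (p (i + 2)) (p (i + 3))"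
    "det3 (p (i + 1)) (p (i + 3)) (p (i + 3)) = 0"
    "det3 (p (i + 2)) (p (i + 4)) (p i) = det3 (p i) (p (i + 2)) (p (i + 4))"
    "det3 (p (i + 2)) (p (i + 4)) (p (i + 2)) = 0"
    "det3 (p (i + 2)) (p (i + 4)) (p (i + 3)) = - det3 (p (i + 2)) (p (i + 3)) (p (i + 4))"
    by (simp_all add: det3_expand)
  show "det3 (p (i + 1)) (p (i + 3)) (shifted_glick p (p i)) = 0"
    "det3 (p (i + 2)) (p (i + 4)) (shifted_glick p (p i)) = 0"
    unfolding shifted_glick_vertex[of p, OF assms] lin perm using nz by simp_all
qed

text \<open>The image of vertex \<open>i\<close> lies on the diagonals \<open>(i + 1, i + 3)\<close>
  and \<open>(i + 2, i + 4)\<close>, whose intersection carries the label \<open>i + 1\<close>. The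
  scalar is the third coordinate \<open>1 + a + b\<close>, hence positive.\<close>

lemma lift_pentagram:
  assumes conv: "convex_lifts \<sigma> (\<lambda>i. lift (P i))"
  shows "\<exists>t>0. shifted_glick (\<lambda>i. lift (P i)) (lift (P i)) = t *\<^sub>R lift (pentagram P (i + 1))"
proof -
  let ?v = "shifted_glick (\<lambda>i. lift (P i)) (lift (P i))"
  obtain a b where ab: "a > 0" "b > 0" "?v = lift (P i) + a *\<^sub>R lift (P (i + 2)) + b *\<^sub>R lift (P (i
      + 3))"
    using shifted_glick_vertex_pos[OF conv] by metis
  define t where "t = 1 + a + b"
  have "t > 0" using ab by (simp add: t_def)
  define x where "x = (1 / t) *\<^sub>R (P i + a *\<^sub>R P (i + 2) + b *\<^sub>R P (i + 3))"
  have v: "?v = t *\<^sub>R lift x"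
    using \<open>t > 0\<close> by (simp add: ab(3) vec_eq_iff forall_3 x_def) (simp add: t_def)
  have "det3 y z (t *\<^sub>R lift x) = t * det3 y z (lift x)" for y z
    by (simp add: det3_expand algebra_simps)
  with \<open>t > 0\<close> have "det3 (lift (P (i + 1))) (lift (P (i + 3))) (lift x) = 0"
    "det3 (lift (P (i + 2))) (lift (P (i + 4))) (lift x) = 0"
    using shifted_glick_vertex_on_diagonals[of "\<lambda>i. lift (P i)" i, OF convex_lifts_nonzero(1)[OF conv]]
    by (simp_all add: v)
  then have "pentagram P (i + 1) = x"
    by (intro pentagram_eqI[OF conv]) (simp_all add: add.assoc)
  with v \<open>t > 0\<close> show ?thesis by auto
qed

lemma convex_lifts_relabel:
  assumes "convex_lifts \<sigma> (\<lambda>i. p (i + s))"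
  shows "convex_lifts \<sigma> p"
proof -
  have "0 < \<sigma> * det3 (p (i - s + s)) (p (i - s + 1 + s)) (p (i - s + 2 + s)) \<and>
        0 < \<sigma> * det3 (p (i - s + s)) (p (i - s + 1 + s)) (p (i - s + 3 + s))" for i
    using assms unfolding convex_lifts_def by blast
  moreover have "i - s + s = i" "i - s + 1 + s = i + 1" "i - s + 2 + s = i + 2" "i - s + 3 + s = i +
      3" for i
    by simp_all
  ultimately show ?thesis unfolding convex_lifts_def by (simp only: simp_thms)
qed

lemma convex_lifts_linear_image:
  assumes "convex_lifts \<sigma> p" "linear f" "det (matrix f) \<noteq> 0" "\<And>i. c i > 0"
  shows "convex_lifts (\<sigma> * det (matrix f)) (\<lambda>i. c i *\<^sub>R f (p i))"
proof -
  have "0 < \<sigma> * det (matrix f) * det3 (c i *\<^sub>R f (p i)) (c j *\<^sub>R f (p j)) (c k *\<^sub>R f (p k))"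
    if "0 < \<sigma> * det3 (p i) (p j) (p k)" for i j k
  proof -
    have "0 < (c i * c j * c k) * (det (matrix f))\<^sup>2 * (\<sigma> * det3 (p i) (p j) (p k))"
      using that assms(3,4) by simp
    then show ?thesis
      by (simp add: det3_scale det3_linear[OF assms(2)] power2_eq_square mult_ac)
  qed
  with assms(1) show ?thesis unfolding convex_lifts_def by blast
qed

section \<open>Powers of the operator and iterates of the map\<close>

lemma linear_funpow: "linear f \<Longrightarrow> linear (f ^^ n)"
  for f :: "real^3 \<Rightarrow> real^3"
proof (induction n)
  case (Suc n)
  then show ?case using linear_compose[of "f ^^ n" f] by (simp add: o_def)
qed (simp add: linear_id)

lemma det_matrix_funpow:
  fixes f :: "real^3 \<Rightarrow> real^3"
  assumes "linear f" "det (matrix f) \<noteq> 0"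
  shows "det (matrix (f ^^ n)) \<noteq> 0"
proof (induction n)
  case 0
  show ?case unfolding funpow.simps(1) matrix_id_mat_1 by simp
next
  case (Suc n)
  have "matrix (f ^^ Suc n) = matrix f ** matrix (f ^^ n)"
    using matrix_compose[OF linear_funpow[OF assms(1)] assms(1), of n] by simp
  with Suc assms(2) show ?case by (simp only: det_mul) simp
qed

text \<open>Every step needs convexity of the current iterate, so it is carried along in the
  induction; it is inherited from \<open>P\<close>, whose lifts are mapped linearly and rescaled by
  positive factors.\<close>

lemma pentagram_funpow:
  assumes conv: "convex_lifts \<sigma> (\<lambda>i. lift (P i))"
    and det: "det (matrix (shifted_glick (\<lambda>i. lift (P i)))) \<noteq> 0"
  defines "G \<equiv> shifted_glick (\<lambda>i. lift (P i))"
  shows "(\<exists>t. \<forall>i. t i > 0 \<and> (G ^^ k) (lift (P i)) = t i *\<^sub>R lift ((pentagram ^^ k) P (i + of_nat k)))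
    \<and> (\<exists>\<sigma>. convex_lifts \<sigma> (\<lambda>i. lift ((pentagram ^^ k) P i)))"
proof (induction k)
  case 0
  show ?case using conv by (auto intro!: exI[of _ "\<lambda>_. 1"])
next
  case (Suc k)
  define Q where "Q = (pentagram ^^ k) P"
  obtain t \<tau> where t: "\<And>i. t i > 0" "\<And>i. (G ^^ k) (lift (P i)) = t i *\<^sub>R lift (Q (i + of_nat k))"
    and convQ: "convex_lifts \<tau> (\<lambda>i. lift (Q i))"
    using Suc unfolding Q_def by metis
  have lin: "linear G" by (simp add: G_def linear_shifted_glick)
  note link = linear_funpow[OF lin, of k] and detk = det_matrix_funpow[OF lin det[folded G_def], of k]
  have t0: "1 / t i \<noteq> 0" for i using t(1)[of i] by simp
  have Q: "lift (Q (i + of_nat k)) = (1 / t i) *\<^sub>R (G ^^ k) (lift (P i))" for i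
    using t(1)[of i] by (simp add: t(2))
  let ?GQ = "shifted_glick (\<lambda>i. lift (Q i))"
  \<comment> \<open>Up to relabelling and rescaling, the lifts of \<open>Q\<close> are the images of
    those of \<open>P\<close>, so the operator of \<open>Q\<close> is \<open>G\<close> conjugated by
    its own power, that is, \<open>G\<close>.\<close>
  have GQ: "?GQ ((G ^^ k) v) = (G ^^ k) (G v)" for v
  proof -
    have "?GQ = shifted_glick (\<lambda>i. lift (Q (i + of_nat k)))"
      by (rule shifted_glick_relabel[symmetric])
    also have "\<dots> = shifted_glick (\<lambda>i. (1 / t i) *\<^sub>R (G ^^ k) (lift (P i)))"
      by (simp only: Q)
    also have "\<dots> = shifted_glick (\<lambda>i. (G ^^ k) (lift (P i)))"
      using shifted_glick_scale[of "\<lambda>i. 1 / t i", OF t0] by (simp add: fun_eq_iff)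
    finally show ?thesis
      using shifted_glick_linear_image[OF link detk, of "\<lambda>i. lift (P i)" v] by (simp add: G_def)
  qed
  have "\<exists>s>0. (G ^^ Suc k) (lift (P i)) = s *\<^sub>R lift (pentagram Q (i + of_nat (Suc k)))" for i
  proof -
    obtain r where r: "r > 0" "?GQ (lift (Q (i + of_nat k))) = r *\<^sub>R lift (pentagram Q (i + of_nat k
        + 1))"
      using lift_pentagram[OF convQ] by blast
    have "(G ^^ Suc k) (lift (P i)) = (G ^^ k) (G (lift (P i)))"
      by (simp add: funpow_swap1)
    also have "\<dots> = ?GQ (t i *\<^sub>R lift (Q (i + of_nat k)))"
      by (simp only: t(2) flip: GQ)
    also have "\<dots> = (t i * r) *\<^sub>R lift (pentagram Q (i + of_nat k + 1))"
      by (simp add: linear_cmul[OF linear_shifted_glick] r(2))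
    finally show ?thesis
      using r(1) t(1)[of i] by (intro exI[of _ "t i * r"]) (simp add: ac_simps)
  qed
  then obtain s where s: "\<And>i. s i > 0" "\<And>i. (G ^^ Suc k) (lift (P i)) = s i *\<^sub>R lift (pentagram Q (i
      + of_nat (Suc k)))"
    by metis
  have "lift (pentagram Q (i + of_nat (Suc k))) = (1 / s i) *\<^sub>R (G ^^ Suc k) (lift (P i))" for i
    using s(1)[of i] by (simp only: s(2) scaleR_scaleR) simp
  moreover have "convex_lifts (\<sigma> * det (matrix (G ^^ Suc k))) (\<lambda>i. (1 / s i) *\<^sub>R (G ^^ Suc k) (lift
      (P i)))"
    by (intro convex_lifts_linear_image[OF conv] linear_funpow det_matrix_funpow lin det[folded
        G_def]) (simp add: s(1))
  ultimately have "convex_lifts (\<sigma> * det (matrix (G ^^ Suc k))) (\<lambda>i. lift (pentagram Q (i + of_nat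
      (Suc k))))"
    by (simp only:)
  then have "convex_lifts (\<sigma> * det (matrix (G ^^ Suc k))) (\<lambda>i. lift (pentagram Q i))"
    by (rule convex_lifts_relabel[of _ "\<lambda>i. lift (pentagram Q i)"])
  then show ?case using s by (auto simp: Q_def intro!: exI[of _ s] exI[of _ "\<sigma> * det (matrix (G ^^
      Suc k))"])
qed

section \<open>Areas, centroids and homotheties\<close>

lemma area_pos:
  assumes "convex_lifts \<sigma> (\<lambda>i. lift (P i))"
  shows "area P > 0"
proof -
  define d where "d i j k = det3 (lift (P i)) (lift (P j)) (lift (P k))" for i j k
  \<comment> \<open>Fan triangulation from vertex 0: the shoelace sum is a sum of three triangles of
    one orientation.\<close>
  have S: "(\<Sum>i\<in>UNIV. det2 (P i) (P (i + 1))) = d 0 1 2 + d 2 3 0 + d 3 4 0"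
    unfolding sum_5[of _ 0] by (simp add: d_def det3_expand det2_expand algebra_simps)
  have "0 < \<sigma> * d 0 1 2" "0 < \<sigma> * d 2 3 0" "0 < \<sigma> * d 3 4 0"
    using assms[unfolded convex_lifts_def, THEN spec, of 0] assms[unfolded convex_lifts_def, THEN
        spec, of 2]
      assms[unfolded convex_lifts_def, THEN spec, of 3] by (simp_all add: d_def)
  then have "0 < \<sigma> * (\<Sum>i\<in>UNIV. det2 (P i) (P (i + 1)))"
    unfolding S by (simp add: distrib_left)
  then have "(\<Sum>i\<in>UNIV. det2 (P i) (P (i + 1))) \<noteq> 0" by (metis less_irrefl mult_zero_right)
  then show ?thesis by (simp add: area_def)
qed

lemma area_homothety: "area (\<lambda>i. d + s *\<^sub>R (P i - c)) = s\<^sup>2 * area P"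
proof -
  have "(\<Sum>i\<in>UNIV. det2 (d + s *\<^sub>R (P i - c)) (d + s *\<^sub>R (P (i + 1) - c))) = s\<^sup>2 * (\<Sum>i\<in>UNIV. det2 (P
      i) (P (i + 1)))"
    unfolding sum_5[of _ 0] by (simp add: det2_expand power2_eq_square algebra_simps)
  then show ?thesis by (simp add: area_def abs_mult)
qed

lemma centroid_homothety: "centroid (\<lambda>i. d + s *\<^sub>R (P i - c)) = d + s *\<^sub>R (centroid P - c)"
  unfolding centroid_def sum_5[of _ 0] by (simp add: vec_eq_iff field_simps)

lemma det3_homothety:
  "det3 (lift (d + s *\<^sub>R (x - c))) (lift (d + s *\<^sub>R (y - c))) (lift (d + s *\<^sub>R (z - c)))
    = s\<^sup>2 * det3 (lift x) (lift y) (lift z)"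
  by (simp add: det3_expand power2_eq_square algebra_simps)

lemma pentagram_homothety:
  assumes conv: "convex_lifts \<sigma> (\<lambda>i. lift (P i))" and "s \<noteq> 0"
  shows "pentagram (\<lambda>i. d + s *\<^sub>R (P i - c)) = (\<lambda>i. d + s *\<^sub>R (pentagram P i - c))"
proof
  fix i :: 5
  have conv': "convex_lifts \<sigma> (\<lambda>i. lift (d + s *\<^sub>R (P i - c)))"
  proof -
    have "0 < \<sigma> * (s\<^sup>2 * x) \<longleftrightarrow> 0 < \<sigma> * x" for x
      using \<open>s \<noteq> 0\<close> zero_less_mult_pos[of "s\<^sup>2" "\<sigma> * x"] by (auto simp: mult.left_commute[of \<sigma>])
    with conv \<open>s \<noteq> 0\<close> show ?thesis by (simp add: convex_lifts_def det3_homothety)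
  qed
  have idx: "i - 1 + 1 = i" "i - 1 + 2 = i + 1" "i - 1 + 3 = i + 2" "i - 1 + 4 = i + 3" by simp_all
  obtain t where t: "t > 0" "shifted_glick (\<lambda>i. lift (P i)) (lift (P (i - 1))) = t *\<^sub>R lift
      (pentagram P i)"
    using lift_pentagram[OF conv, of "i - 1"] unfolding idx by blast
  have "det3 y z (t *\<^sub>R x) = t * det3 y z x" for x y z
    by (simp add: det3_expand algebra_simps)
  then have "det3 (lift (P i)) (lift (P (i + 2))) (lift (pentagram P i)) = 0"
     "det3 (lift (P (i + 1))) (lift (P (i + 3))) (lift (pentagram P i)) = 0"
    using shifted_glick_vertex_on_diagonals[of "\<lambda>i. lift (P i)" "i - 1", OF
        convex_lifts_nonzero(1)[OF conv]] t
    unfolding idx by simp_all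
  then show "pentagram (\<lambda>i. d + s *\<^sub>R (P i - c)) i = d + s *\<^sub>R (pentagram P i - c)"
    by (intro pentagram_eqI[OF conv']) (simp_all add: det3_homothety)
qed

text \<open>A normalized step keeps centroid and area, and the pentagram map commutes with the
  homothety that normalizes the previous iterate; so all factors telescope into one homothety of the
  plain iterate.\<close>

lemma normalized_pentagram_funpow:
  assumes "\<And>k. \<exists>\<sigma>. convex_lifts \<sigma> (\<lambda>i. lift ((pentagram ^^ k) P i))"
  defines "A \<equiv> \<lambda>k. area ((pentagram ^^ k) P)" and "c \<equiv> \<lambda>k. centroid ((pentagram ^^ k) P)"
  shows "(normalized_pentagram ^^ k) P = (\<lambda>i. centroid P + sqrt (area P / A k) *\<^sub>R ((pentagram ^^ k)
      P i - c k))"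
proof (induction k)
  have A: "A k > 0" for k
    using assms(1)[of k] area_pos by (auto simp: A_def)
  {
    case 0
    show ?case using A[of 0] by (simp add: A_def c_def)
  next
    case (Suc k)
    define s where "s = sqrt (area P / A k)"
    have "area P > 0" using A[of 0] by (simp add: A_def)
    then have s: "s > 0" "s\<^sup>2 = area P / A k" using A[of k] by (simp_all add: s_def)
    define N where "N = (\<lambda>i. centroid P + s *\<^sub>R ((pentagram ^^ k) P i - c k))"
    have cN: "centroid N = centroid P" by (simp add: N_def centroid_homothety c_def)
    have aN: "area N = area P" using s A[of k] by (simp add: N_def area_homothety A_def)
    obtain \<sigma> where "convex_lifts \<sigma> (\<lambda>i. lift ((pentagram ^^ k) P i))" using assms(1) by blast
    then have pN: "pentagram N = (\<lambda>i. centroid P + s *\<^sub>R ((pentagram ^^ Suc k) P i - c k))"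
      using s(1) by (simp add: N_def pentagram_homothety)
    have apN: "area (pentagram N) = s\<^sup>2 * A (Suc k)" unfolding pN area_homothety A_def ..
    have cpN: "centroid (pentagram N) = centroid P + s *\<^sub>R (c (Suc k) - c k)"
      unfolding pN centroid_homothety c_def ..
    have "sqrt (area N / area (pentagram N)) = sqrt (area P / A (Suc k)) / s"
      using s(1) by (simp add: aN apN real_sqrt_divide real_sqrt_mult)
    then have "normalized_pentagram N = (\<lambda>i. centroid P + sqrt (area P / A (Suc k)) *\<^sub>R ((pentagram
        ^^ Suc k) P i - c (Suc k)))"
      unfolding fun_eq_iff normalized_pentagram_def cN cpN
      using s(1) by (simp add: pN del: funpow.simps flip: scaleR_diff_right)
    with Suc show ?case by (simp add: N_def s_def)
  }
qed

section \<open>Asymptotics of area-normalized pentagons\<close>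

lemma tendsto_MAX:
  fixes f :: "'i \<Rightarrow> 'a \<Rightarrow> real"
  assumes "finite I" "I \<noteq> {}" "\<And>i. i \<in> I \<Longrightarrow> (f i \<longlongrightarrow> l i) F"
  shows "((\<lambda>x. MAX i\<in>I. f i x) \<longlongrightarrow> (MAX i\<in>I. l i)) F"
  using assms
proof (induction I rule: finite_ne_induct)
  case (insert i I)
  then show ?case by (simp add: tendsto_max)
qed simp

text \<open>As a maximum over finitely many pairs of labels, the diameter passes to the
  limit.\<close>

lemma diam_eq_Max: "diam Q = (MAX (i, j)\<in>UNIV. dist (Q i) (Q j))"
proof -
  have "(\<lambda>(x, y). dist x y) ` (range Q \<times> range Q) = range (\<lambda>(i, j). dist (Q i) (Q j))"
    by force
  then show ?thesis
    by (simp add: diam_def diameter_def cSup_eq_Max)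
qed

lemma area_affine_frame:
  "area (\<lambda>i. W + x i *\<^sub>R U + y i *\<^sub>R Z)
    = \<bar>det2 U Z\<bar> / 2 * \<bar>\<Sum>i\<in>UNIV. x i * y (i + 1) - x (i + 1) * y i\<bar>"
proof -
  have "area (\<lambda>i. W + x i *\<^sub>R U + y i *\<^sub>R Z) = area (\<lambda>i. x i *\<^sub>R U + y i *\<^sub>R Z)"
    using area_homothety[of W 1 "\<lambda>i. x i *\<^sub>R U + y i *\<^sub>R Z" 0] by (simp add: add.assoc)
  also have "det2 (x i *\<^sub>R U + y i *\<^sub>R Z) (x (i + 1) *\<^sub>R U + y (i + 1) *\<^sub>R Z)
      = det2 U Z * (x i * y (i + 1) - x (i + 1) * y i)" for i
    by (simp add: det2_expand algebra_simps)
  then have "area (\<lambda>i. x i *\<^sub>R U + y i *\<^sub>R Z)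
    = \<bar>1 / 2 * (det2 U Z * (\<Sum>i\<in>UNIV. x i * y (i + 1) - x (i + 1) * y i))\<bar>"
    by (simp add: area_def sum_distrib_left)
  finally show ?thesis by (simp add: abs_mult)
qed

lemma centroid_affine_frame:
  "centroid (\<lambda>i. W + x i *\<^sub>R U + y i *\<^sub>R Z)
    = W + ((\<Sum>i\<in>UNIV. x i) / 5) *\<^sub>R U + ((\<Sum>i\<in>UNIV. y i) / 5) *\<^sub>R Z"
  unfolding centroid_def sum_5[of _ 0] by (simp add: vec_eq_iff field_simps)

text \<open>The area of \<open>X k\<close> is of order \<open>\<bar>r * s\<bar> ^ k\<close>, so
  normalization divides by \<open>p ^ k\<close> with \<open>p = sqrt \<bar>r * s\<bar>\<close>. This
  turns \<open>\<bar>r\<bar> ^ k\<close> into \<open>1 / q ^ k\<close> along \<open>U\<close> and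
  \<open>\<bar>s\<bar> ^ k\<close> into \<open>q ^ k\<close> along \<open>Z\<close>.\<close>

lemma rescaled_pentagon_asymptotics:
  fixes X N :: "nat \<Rightarrow> pentagon" and b g :: "nat \<Rightarrow> 5 \<Rightarrow> real"
  assumes X: "\<And>k i. X k i = W + (r ^ k * b k i) *\<^sub>R U + (s ^ k * g k i) *\<^sub>R Z"
    and N: "\<And>k i. N k i = C + sqrt (A / area (X k)) *\<^sub>R (X k i - centroid (X k))"
    and b: "\<And>i. (\<lambda>k. b k i) \<longlonglongrightarrow> b' i" and g: "\<And>i. (\<lambda>k. g k i) \<longlonglongrightarrow> g' i"
    and area_limit: "(\<Sum>i\<in>UNIV. b' i * g' (i + 1) - b' (i + 1) * g' i) \<noteq> 0"
    and UZ: "det2 U Z \<noteq> 0" and "r \<noteq> 0" "s \<noteq> 0" "\<bar>s\<bar> < \<bar>r\<bar>" "A > 0"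
  defines "q \<equiv> sqrt \<bar>s / r\<bar>"
  shows "\<exists>B. convergent B \<and> (\<forall>k. max_dist_to_line (N k) (line_through C U) \<le> B k * q ^ k)"
    and "\<exists>D>0. (\<lambda>k. diam (N k) * q ^ k) \<longlonglongrightarrow> D"
proof -
  define S where "S k = (\<Sum>i\<in>UNIV. b k i * g k (i + 1) - b k (i + 1) * g k i)" for k
  define S' where "S' = (\<Sum>i\<in>UNIV. b' i * g' (i + 1) - b' (i + 1) * g' i)"
  define m where "m k = sqrt (A / (\<bar>det2 U Z\<bar> / 2 * \<bar>S k\<bar>))" for k
  define m' where "m' = sqrt (A / (\<bar>det2 U Z\<bar> / 2 * \<bar>S'\<bar>))"
  define p where "p = sqrt \<bar>r * s\<bar>"
  have "p > 0" using assms by (simp add: p_def)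
  have "q > 0" using assms by (simp add: q_def)
  have pq: "\<bar>r\<bar> * q = p" "\<bar>s\<bar> = p * q"
  proof -
    have "\<bar>r\<bar> * q = (\<bar>r\<bar> / sqrt \<bar>r\<bar>) * sqrt \<bar>s\<bar>"
      by (simp add: q_def abs_divide real_sqrt_divide)
    then show "\<bar>r\<bar> * q = p"
      by (simp add: p_def abs_mult real_sqrt_mult real_div_sqrt)
    have "p * q = sqrt (\<bar>r * s\<bar> * \<bar>s / r\<bar>)" by (simp only: p_def q_def real_sqrt_mult)
    also have "\<bar>r * s\<bar> * \<bar>s / r\<bar> = s\<^sup>2" using \<open>r \<noteq> 0\<close> by (simp add: abs_mult abs_divide power2_eq_square)
    finally show "\<bar>s\<bar> = p * q" by simp
  qed
  have S: "S \<longlonglongrightarrow> S'" unfolding S_def S'_def by (intro tendsto_intros b g)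
  have "S' \<noteq> 0" using area_limit by (simp add: S'_def)
  have m: "m \<longlonglongrightarrow> m'" unfolding m_def m'_def
    by (intro tendsto_intros S) (use UZ \<open>S' \<noteq> 0\<close> in auto)
  have "m' > 0" using UZ \<open>S' \<noteq> 0\<close> \<open>A > 0\<close> by (simp add: m'_def)
  have m0: "m k \<ge> 0" for k using \<open>A > 0\<close> by (simp add: m_def)
  have scale: "sqrt (A / area (X k)) = m k / p ^ k" for k
  proof -
    have "X k = (\<lambda>i. W + (r ^ k * b k i) *\<^sub>R U + (s ^ k * g k i) *\<^sub>R Z)" using X by blast
    moreover have "(\<Sum>i\<in>UNIV. (r ^ k * b k i) * (s ^ k * g k (i + 1)) - (r ^ k * b k (i + 1)) * (s ^
        k * g k i)) = (r * s) ^ k * S k"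
      by (simp add: S_def sum_distrib_left power_mult_distrib algebra_simps)
    ultimately have "area (X k) = \<bar>det2 U Z\<bar> / 2 * \<bar>(r * s) ^ k * S k\<bar>"
      by (simp only: area_affine_frame)
    also have "\<dots> = \<bar>r * s\<bar> ^ k * (\<bar>det2 U Z\<bar> / 2 * \<bar>S k\<bar>)"
      by (simp add: abs_mult power_abs)
    finally have "A / area (X k) = (A / (\<bar>det2 U Z\<bar> / 2 * \<bar>S k\<bar>)) / \<bar>r * s\<bar> ^ k"
      by (simp only: divide_divide_eq_left mult.commute)
    then show ?thesis by (simp only: real_sqrt_divide real_sqrt_power m_def p_def)
  qed
  define bm where "bm k = (\<Sum>i\<in>UNIV. b k i) / 5" for k
  define gm where "gm k = (\<Sum>i\<in>UNIV. g k i) / 5" for k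
  have N': "N k i = C + (m k / p ^ k) *\<^sub>R ((r ^ k * (b k i - bm k)) *\<^sub>R U + (s ^ k * (g k i - gm k))
      *\<^sub>R Z)" for k i
  proof -
    have "X k = (\<lambda>i. W + (r ^ k * b k i) *\<^sub>R U + (s ^ k * g k i) *\<^sub>R Z)" using X by blast
    then have "centroid (X k) = W + (r ^ k * bm k) *\<^sub>R U + (s ^ k * gm k) *\<^sub>R Z"
      by (simp add: centroid_affine_frame bm_def gm_def flip: sum_distrib_left)
    then show ?thesis
      unfolding N scale by (simp add: X algebra_simps)
  qed
  show "\<exists>B. convergent B \<and> (\<forall>k. max_dist_to_line (N k) (line_through C U) \<le> B k * q ^ k)"
  proof (intro exI conjI allI)
    define B where "B k = (\<Sum>i\<in>UNIV. m k * \<bar>g k i - gm k\<bar> * norm Z)" for k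
    have "B \<longlonglongrightarrow> (\<Sum>i\<in>UNIV. m' * \<bar>g' i - (\<Sum>i\<in>UNIV. g' i) / 5\<bar> * norm Z)"
      unfolding B_def gm_def by (intro tendsto_intros m g) auto
    then show "convergent B" by (auto simp: convergent_def)
    fix k
    have dist: "infdist (N k i) (line_through C U) \<le> m k * \<bar>g k i - gm k\<bar> * norm Z * q ^ k" for i
    proof -
      \<comment> \<open>Any point of the line bounds the distance; this one differs from the vertex
        only by the \<open>Z\<close>-component.\<close>
      let ?y = "C + (m k / p ^ k * (r ^ k * (b k i - bm k))) *\<^sub>R U"
      have "?y \<in> line_through C U" by (auto simp: line_through_def)
      then have "infdist (N k i) (line_through C U) \<le> dist (N k i) ?y" by (rule infdist_le)
      also have "dist (N k i) ?y = norm ((m k / p ^ k * (s ^ k * (g k i - gm k))) *\<^sub>R Z)"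
        by (simp add: N' dist_norm algebra_simps)
      also have "\<dots> = m k / p ^ k * (\<bar>s\<bar> ^ k * \<bar>g k i - gm k\<bar>) * norm Z"
        using m0[of k] \<open>p > 0\<close> by (simp add: abs_mult power_abs)
      also have "\<dots> = m k * \<bar>g k i - gm k\<bar> * norm Z * q ^ k"
        using \<open>p > 0\<close> unfolding pq(2) by (simp add: power_mult_distrib)
      finally show ?thesis .
    qed
    have "m k * \<bar>g k i - gm k\<bar> * norm Z \<le> B k" for i
      unfolding B_def by (rule member_le_sum) (use m0 in auto)
    then have "infdist (N k i) (line_through C U) \<le> B k * q ^ k" for i
      using dist[of i] \<open>q > 0\<close> by (meson mult_right_mono order_trans zero_le_power less_imp_le)
    then show "max_dist_to_line (N k) (line_through C U) \<le> B k * q ^ k"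
      unfolding max_dist_to_line_def by (subst Max_le_iff) auto
  qed
  define D where "D = (MAX (i, j)\<in>UNIV. m' * norm ((b' i - b' j) *\<^sub>R U))"
  have dist: "dist (N k i) (N k j) * q ^ k
      = m k * norm ((b k i - b k j) *\<^sub>R U + ((s / r) ^ k * (g k i - g k j)) *\<^sub>R Z)" for k i j
  proof -
    have "r ^ k * (s / r) ^ k = s ^ k" using \<open>r \<noteq> 0\<close> by (simp flip: power_mult_distrib)
    then have "N k i - N k j = (m k / p ^ k * r ^ k) *\<^sub>R
        ((b k i - b k j) *\<^sub>R U + ((s / r) ^ k * (g k i - g k j)) *\<^sub>R Z)"
      by (simp add: N' algebra_simps mult.left_commute[of "r ^ k"])
    then have e1: "dist (N k i) (N k j) = (m k / p ^ k * \<bar>r\<bar> ^ k) * norm ((b k i - b k j) *\<^sub>R U +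
        ((s / r) ^ k * (g k i - g k j)) *\<^sub>R Z)"
      using m0[of k] \<open>p > 0\<close> by (simp add: dist_norm abs_mult power_abs)
    have e2: "m k / p ^ k * \<bar>r\<bar> ^ k * q ^ k = m k"
    proof -
      have "m k / p ^ k * \<bar>r\<bar> ^ k * q ^ k = m k / p ^ k * (\<bar>r\<bar> * q) ^ k"
        by (simp add: power_mult_distrib)
      then show ?thesis using \<open>p > 0\<close> unfolding pq(1) by simp
    qed
    have "x * y * z = (x * z) * y" for x y z :: real by simp
    from this[of "m k / p ^ k * \<bar>r\<bar> ^ k" _ "q ^ k"] show ?thesis unfolding e1 e2 .
  qed
  have "norm (s / r) < 1" using assms by (simp add: abs_divide)
  then have "(\<lambda>k. dist (N k i) (N k j) * q ^ k) \<longlonglongrightarrow>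
      m' * norm ((b' i - b' j) *\<^sub>R U + (0 * (g' i - g' j)) *\<^sub>R Z)" for i j
    unfolding dist by (intro tendsto_intros m b g) auto
  then have "(\<lambda>k. MAX ij\<in>UNIV. (case ij of (i, j) \<Rightarrow> dist (N k i) (N k j) * q ^ k)) \<longlonglongrightarrow> D"
    unfolding D_def by (intro tendsto_MAX) auto
  moreover have "diam (N k) * q ^ k = (MAX ij\<in>UNIV. (case ij of (i, j) \<Rightarrow> dist (N k i) (N k j) * q ^
      k))" for k
  proof -
    have "mono (\<lambda>x. x * q ^ k)" using \<open>q > 0\<close> by (intro monoI mult_right_mono) auto
    then show ?thesis
      unfolding diam_eq_Max by (subst mono_Max_commute) (auto simp: image_image case_prod_unfold)
  qed
  ultimately have lim: "(\<lambda>k. diam (N k) * q ^ k) \<longlonglongrightarrow> D" by simp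
  \<comment> \<open>If all \<open>b'\<close> agreed, the limiting area would telescope to zero; so
    some pair of vertices stays apart along \<open>U\<close>, which makes \<open>D\<close>
    positive.\<close>
  have "\<exists>i j. b' i \<noteq> b' j"
  proof (rule ccontr)
    assume "\<not> ?thesis"
    then obtain c where "b' i = c" for i by metis
    then have "S' = c * (\<Sum>i\<in>UNIV. g' (i + 1) - g' i)"
      unfolding S'_def by (simp add: sum_distrib_left right_diff_distrib)
    also have "\<dots> = 0" unfolding sum_5[of _ 0] by simp
    finally show False using \<open>S' \<noteq> 0\<close> by simp
  qed
  then obtain i j where "b' i \<noteq> b' j" by blast
  moreover have "U \<noteq> 0" using UZ by (auto simp: det2_expand)
  ultimately have "0 < m' * norm ((b' i - b' j) *\<^sub>R U)" using \<open>m' > 0\<close> by simp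
  also have "\<dots> \<le> D" unfolding D_def by (rule Max_ge) (auto intro!: image_eqI[of _ _ "(i, j)"])
  finally show "\<exists>D>0. (\<lambda>k. diam (N k) * q ^ k) \<longlonglongrightarrow> D" using lim by blast
qed

section \<open>Eigencoordinates\<close>

lemma eigenvectors_det3_nonzero:
  assumes f: "linear f" and "eigenvector_for f a x" "eigenvector_for f b y" "eigenvector_for f c z"
    and "a \<noteq> b" "a \<noteq> c" "b \<noteq> c"
  shows "det3 x y z \<noteq> 0"
proof
  assume "det3 x y z = 0"
  then obtain r s t where nz: "(r, s, t) \<noteq> (0, 0, 0)" and eq: "r *\<^sub>R x + s *\<^sub>R y + t *\<^sub>R z = 0"
    using det3_zero_imp_dependent by blast
  have key: "p = 0"
    if "eigenvector_for f i u" "eigenvector_for f j v" "eigenvector_for f k w" "i \<noteq> j" "i \<noteq> k"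
      "p *\<^sub>R u + q *\<^sub>R v + l *\<^sub>R w = 0" for i j k u v w p q l
  proof -
    have ev: "f u = i *\<^sub>R u" "f v = j *\<^sub>R v" "f w = k *\<^sub>R w" "u \<noteq> 0"
      using that by (auto simp: eigenvector_for_def)
    \<comment> \<open>The operator \<open>(f - j) (f - k)\<close> kills \<open>v\<close> and
      \<open>w\<close> and multiplies \<open>u\<close> by \<open>(i - j) * (i - k)\<close>.\<close>
    define h where "h x = f (f x) - (j + k) *\<^sub>R f x + (j * k) *\<^sub>R x" for x
    have "h (p *\<^sub>R u + q *\<^sub>R v + l *\<^sub>R w) = (p * ((i - j) * (i - k))) *\<^sub>R u"
      by (simp add: h_def linear_add[OF f] linear_cmul[OF f] ev algebra_simps)
    moreover have "h 0 = 0" by (simp add: h_def linear_0[OF f])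
    ultimately show ?thesis using that ev(4) by simp
  qed
  have "r = 0" by (rule key[OF assms(2-4) _ _ eq]) fact+
  moreover have "s = 0"
    by (rule key[OF assms(3,2,4), of s r t]) (use assms eq in \<open>auto simp: add.commute\<close>)
  moreover have "t = 0"
    by (rule key[OF assms(4,2,3), of t r s]) (use assms eq in \<open>auto simp: algebra_simps\<close>)
  ultimately show False using nz by simp
qed

lemma funpow_eigenvector:
  fixes f :: "real^3 \<Rightarrow> real^3"
  assumes "linear f" "f x = a *\<^sub>R x"
  shows "(f ^^ k) x = a ^ k *\<^sub>R x"
  by (induction k) (simp_all add: linear_cmul[OF assms(1)] assms(2) mult.commute)

text \<open>
  The vectors \<open>x\<close> with \<open>norm x \<le> c * x $ 3\<close> form a closed cone containing all iterates of the lifts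
  of \<open>P\<close>; rescaled, these tend to multiples of \<open>w1\<close>, which must therefore lie on one side.
\<close>

lemma dominant_coordinate_pos:
  fixes P :: pentagon
  assumes conv: "convex_lifts \<sigma> (\<lambda>i. lift (P i))"
  defines "G \<equiv> shifted_glick (\<lambda>i. lift (P i))"
  assumes ev: "G w1 = m1 *\<^sub>R w1" "G w2 = m2 *\<^sub>R w2" "G w3 = m3 *\<^sub>R w3"
    and m: "m1 > 0" "\<bar>m2\<bar> < m1" "\<bar>m3\<bar> < m1" and det: "det3 w1 w2 w3 \<noteq> 0"
    and coord: "\<And>i. lift (P i) = \<alpha> i *\<^sub>R w1 + \<beta> i *\<^sub>R w2 + \<gamma> i *\<^sub>R w3"
  shows "\<alpha> i * w1 $ 3 > 0"
proof -
  have lin: "linear G" by (simp add: G_def linear_shifted_glick)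
  have "\<exists>a b. a > 0 \<and> b > 0 \<and> G (lift (P i)) = lift (P i) + a *\<^sub>R lift (P (i + 2)) + b *\<^sub>R lift (P
      (i + 3))" for i
    using shifted_glick_vertex_pos[OF conv, of i] unfolding G_def by blast
  then obtain a b where ab: "\<And>i. a i > 0" "\<And>i. b i > 0"
    and G: "\<And>i. G (lift (P i)) = lift (P i) + a i *\<^sub>R lift (P (i + 2)) + b i *\<^sub>R lift (P (i + 3))"
    by metis
  \<comment> \<open>Each lift has third coordinate 1, so the sum of all norms is an aperture valid
    for every vertex.\<close>
  define c where "c = (\<Sum>i\<in>UNIV. norm (lift (P i)))"
  have cone: "norm ((G ^^ k) (lift (P i))) \<le> c * (G ^^ k) (lift (P i)) $ 3" for k i
  proof (induction k arbitrary: i)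
    case 0
    show ?case using member_le_sum[of i UNIV "\<lambda>i. norm (lift (P i))"] by (simp add: c_def)
  next
    case (Suc k)
    let ?v = "\<lambda>j. (G ^^ k) (lift (P j))"
    note link = linear_funpow[OF lin, of k]
    have "(G ^^ Suc k) (lift (P i)) = (G ^^ k) (G (lift (P i)))"
      by (simp add: funpow_swap1)
    then have eq: "(G ^^ Suc k) (lift (P i)) = ?v i + a i *\<^sub>R ?v (i + 2) + b i *\<^sub>R ?v (i + 3)"
      by (simp add: G linear_add[OF link] linear_cmul[OF link])
    have "norm ((G ^^ Suc k) (lift (P i))) \<le> norm (?v i) + a i * norm (?v (i + 2)) + b i * norm (?v
        (i + 3))"
      unfolding eq using ab[of i] by (intro norm_triangle_le add_mono) auto
    also have "\<dots> \<le> c * ?v i $ 3 + a i * (c * ?v (i + 2) $ 3) + b i * (c * ?v (i + 3) $ 3)"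
      using ab[of i] by (intro add_mono mult_left_mono Suc) auto
    also have "\<dots> = c * (G ^^ Suc k) (lift (P i)) $ 3"
      unfolding eq by (simp add: algebra_simps)
    finally show ?case .
  qed
  have "norm (\<alpha> i *\<^sub>R w1) \<le> c * (\<alpha> i *\<^sub>R w1) $ 3" for i
  proof (rule tendsto_le[OF sequentially_bot])
    let ?x = "\<lambda>k. (1 / m1 ^ k) *\<^sub>R (G ^^ k) (lift (P i))"
    have "?x k = \<alpha> i *\<^sub>R w1 + ((m2 / m1) ^ k * \<beta> i) *\<^sub>R w2 + ((m3 / m1) ^ k * \<gamma> i) *\<^sub>R w3" for k
    proof -
      note link = linear_funpow[OF lin, of k]
      show ?thesis
        unfolding coord[of i] linear_add[OF link] linear_cmul[OF link] funpow_eigenvector[OF lin ev(1)]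
          funpow_eigenvector[OF lin ev(2)] funpow_eigenvector[OF lin ev(3)]
        using m(1) by (simp add: scaleR_add_right power_divide mult.commute)
    qed
    then have "?x = (\<lambda>k. \<alpha> i *\<^sub>R w1 + ((m2 / m1) ^ k * \<beta> i) *\<^sub>R w2 + ((m3 / m1) ^ k * \<gamma> i) *\<^sub>R w3)"
      by blast
    moreover have "\<dots> \<longlonglongrightarrow> \<alpha> i *\<^sub>R w1 + (0 * \<beta> i) *\<^sub>R w2 + (0 * \<gamma> i) *\<^sub>R w3"
      by (intro tendsto_intros) (use m in auto)
    ultimately have lim: "?x \<longlonglongrightarrow> \<alpha> i *\<^sub>R w1" by simp
    show "(\<lambda>k. norm (?x k)) \<longlonglongrightarrow> norm (\<alpha> i *\<^sub>R w1)" by (intro tendsto_intros lim)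
    show "(\<lambda>k. c * ?x k $ 3) \<longlonglongrightarrow> c * (\<alpha> i *\<^sub>R w1) $ 3" by (intro tendsto_intros lim)
    show "\<forall>\<^sub>F k in sequentially. norm (?x k) \<le> c * ?x k $ 3"
    proof (intro always_eventually allI)
      fix k
      have "norm (?x k) = 1 / m1 ^ k * norm ((G ^^ k) (lift (P i)))" using m(1) by simp
      also have "\<dots> \<le> 1 / m1 ^ k * (c * (G ^^ k) (lift (P i)) $ 3)"
        using m(1) by (intro mult_left_mono cone) simp
      finally show "norm (?x k) \<le> c * ?x k $ 3" by (simp add: mult.left_commute)
    qed
  qed
  then have bound: "norm (\<alpha> i *\<^sub>R w1) \<le> c * (\<alpha> i * w1 $ 3)" for i by simp
  have "c > 0"
    unfolding c_def by (rule sum_pos) (auto simp: vec_eq_iff forall_3)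
  have "w1 \<noteq> 0" using det by (auto simp: det3_expand)
  have nonneg: "\<alpha> i * w1 $ 3 \<ge> 0" for i
  proof -
    have "0 \<le> c * (\<alpha> i * w1 $ 3)" by (rule order_trans[OF norm_ge_zero bound])
    then show ?thesis using mult_le_cancel_left_pos[OF \<open>c > 0\<close>, of 0 "\<alpha> i * w1 $ 3"] by simp
  qed
  have zero: "\<alpha> i = 0" if "\<alpha> i * w1 $ 3 = 0" for i
  proof -
    have "norm (\<alpha> i *\<^sub>R w1) \<le> 0" using bound[of i] unfolding that by (simp only: mult_zero_right)
    then have "\<alpha> i *\<^sub>R w1 = 0" by (simp only: norm_le_zero_iff)
    then show ?thesis using \<open>w1 \<noteq> 0\<close> by simp
  qed
  \<comment> \<open>The \<open>w1\<close>-coordinates of the two expressions for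
    \<open>G (lift (P i))\<close> are compared; \<open>h\<close> is, up to a factor, the coordinate
    functional.\<close>
  have rel: "m1 * \<alpha> i = \<alpha> i + a i * \<alpha> (i + 2) + b i * \<alpha> (i + 3)" for i
  proof -
    define h where "h x = det3 x w2 w3" for x
    have h: "h (p *\<^sub>R w1 + q *\<^sub>R w2 + r *\<^sub>R w3) = p * det3 w1 w2 w3" for p q r
      by (simp add: h_def det3_expand algebra_simps)
    have hl: "h (x + p *\<^sub>R y + q *\<^sub>R z) = h x + p * h y + q * h z" for x y z p q
      by (simp add: h_def det3_expand algebra_simps)
    have h\<alpha>: "h (lift (P i)) = \<alpha> i * det3 w1 w2 w3" for i unfolding coord by (rule h)
    have "G (lift (P i)) = (m1 * \<alpha> i) *\<^sub>R w1 + (m2 * \<beta> i) *\<^sub>R w2 + (m3 * \<gamma> i) *\<^sub>R w3"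
      unfolding coord[of i] by (simp add: linear_add[OF lin] linear_cmul[OF lin] ev mult.commute)
    then have "m1 * \<alpha> i * det3 w1 w2 w3 = h (G (lift (P i)))" by (simp only: h)
    also have "\<dots> = (\<alpha> i + a i * \<alpha> (i + 2) + b i * \<alpha> (i + 3)) * det3 w1 w2 w3"
      unfolding G hl h\<alpha> by (simp add: algebra_simps)
    finally show ?thesis using det by simp
  qed
  \<comment> \<open>A vanishing coordinate forces a sum of two nonnegative terms to vanish. Zeros
    thus propagate by steps of 2, which reach all labels modulo 5, and three consecutive lifts would
    be dependent.\<close>
  have step: "\<alpha> (i + 2) = 0" if "\<alpha> i = 0" for i
  proof (rule zero)
    have "m1 * (\<alpha> i * w1 $ 3) = \<alpha> i * w1 $ 3 + a i * (\<alpha> (i + 2) * w1 $ 3) + b i * (\<alpha> (i + 3) * w1 $ 3)"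
      using arg_cong[OF rel[of i], of "\<lambda>x. x * w1 $ 3"] by (simp add: algebra_simps)
    then have "a i * (\<alpha> (i + 2) * w1 $ 3) + b i * (\<alpha> (i + 3) * w1 $ 3) = 0"
      using that by simp
    moreover have "a i * (\<alpha> (i + 2) * w1 $ 3) \<ge> 0" "b i * (\<alpha> (i + 3) * w1 $ 3) \<ge> 0"
      using ab[of i] by (simp_all only: mult_nonneg_nonneg[OF less_imp_le nonneg])
    ultimately have "a i * (\<alpha> (i + 2) * w1 $ 3) = 0" by linarith
    then show "\<alpha> (i + 2) * w1 $ 3 = 0" using ab[of i] by simp
  qed
  have "\<alpha> i \<noteq> 0"
  proof
    assume "\<alpha> i = 0"
    then have z: "\<alpha> (i + 2) = 0" "\<alpha> (i + 4) = 0" "\<alpha> (i + 1) = 0" "\<alpha> (i + 3) = 0"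
      using step[of i] step[of "i + 2"] step[of "i + 4"] step[of "i + 1"] by (simp_all add: add.assoc)
    have "det3 (lift (P i)) (lift (P (i + 1))) (lift (P (i + 2))) = 0"
      unfolding coord det3_lincomb by (simp add: z \<open>\<alpha> i = 0\<close>)
    with convex_lifts_nonzero(1)[OF conv, of i] show False by simp
  qed
  with zero[of i] nonneg[of i] show ?thesis by (metis less_eq_real_def)
qed

section \<open>Affine lines through eigenpoints\<close>

definition affine_part :: "real^3 \<Rightarrow> real^2" where
  "affine_part v = vector [v $ 1, v $ 2]"

lemma affine_part_nth [simp]: "affine_part v $ 1 = v $ 1" "affine_part v $ 2 = v $ 2"
  by (simp_all add: affine_part_def)

text \<open>A combination of \<open>w\<close> and \<open>v\<close> has third coordinate 1 exactly
  when \<open>w\<close> has coefficient \<open>1 - b * v $ 3\<close>, so \<open>b\<close> multiplies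
  \<open>v\<close> minus \<open>v $ 3\<close> times \<open>w\<close>, a vector at infinity.\<close>

lemma line_affine_part_eq:
  assumes "w $ 3 = 1" "c \<noteq> 0"
  shows "line_affine_part (c *\<^sub>R w) v = line_through (affine_part w) (affine_part (v - v $ 3 *\<^sub>R w))"
proof -
  have span: "y \<in> span {c *\<^sub>R w, v} \<longleftrightarrow> (\<exists>a b. y = a *\<^sub>R w + b *\<^sub>R v)" for y
  proof -
    have "y \<in> span {c *\<^sub>R w, v} \<longleftrightarrow> (\<exists>a b. y - a *\<^sub>R c *\<^sub>R w = b *\<^sub>R v)"
      by (auto simp: span_insert span_singleton)
    also have "\<dots> \<longleftrightarrow> (\<exists>a b. y = a *\<^sub>R w + b *\<^sub>R v)"
    proof
      assume "\<exists>a b. y - a *\<^sub>R c *\<^sub>R w = b *\<^sub>R v"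
      then show "\<exists>a b. y = a *\<^sub>R w + b *\<^sub>R v" by (metis diff_eq_eq add.commute scaleR_scaleR)
    next
      assume "\<exists>a b. y = a *\<^sub>R w + b *\<^sub>R v"
      then obtain a b where "y = a *\<^sub>R w + b *\<^sub>R v" by blast
      then have "y - (a / c) *\<^sub>R c *\<^sub>R w = b *\<^sub>R v" using \<open>c \<noteq> 0\<close> by simp
      then show "\<exists>a b. y - a *\<^sub>R c *\<^sub>R w = b *\<^sub>R v" by blast
    qed
    finally show ?thesis .
  qed
  have "(\<exists>a b. lift x = a *\<^sub>R w + b *\<^sub>R v) \<longleftrightarrow> (\<exists>b. x = affine_part w + b *\<^sub>R affine_part (v - v $ 3
      *\<^sub>R w))" for x
  proof
    assume "\<exists>a b. lift x = a *\<^sub>R w + b *\<^sub>R v"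
    then obtain a b where ab: "lift x = a *\<^sub>R w + b *\<^sub>R v" by blast
    have "1 = a + b * v $ 3" using arg_cong[OF ab, of "\<lambda>y. y $ 3"] assms(1) by simp
    then have "a = 1 - b * v $ 3" by simp
    with ab have ab: "lift x = (1 - b * v $ 3) *\<^sub>R w + b *\<^sub>R v" by simp
    then have "x = affine_part w + b *\<^sub>R affine_part (v - v $ 3 *\<^sub>R w)"
      using arg_cong[OF ab, of "\<lambda>y. y $ 1"] arg_cong[OF ab, of "\<lambda>y. y $ 2"]
      by (simp add: vec_eq_iff forall_2 algebra_simps)
    then show "\<exists>b. x = affine_part w + b *\<^sub>R affine_part (v - v $ 3 *\<^sub>R w)" by blast
  next
    assume "\<exists>b. x = affine_part w + b *\<^sub>R affine_part (v - v $ 3 *\<^sub>R w)"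
    then obtain b where "x = affine_part w + b *\<^sub>R affine_part (v - v $ 3 *\<^sub>R w)" by blast
    then have "lift x = (1 - b * v $ 3) *\<^sub>R w + b *\<^sub>R v"
      using assms(1) by (simp add: vec_eq_iff forall_3 algebra_simps)
    then show "\<exists>a b. lift x = a *\<^sub>R w + b *\<^sub>R v" by blast
  qed
  then show ?thesis
    by (auto simp: line_affine_part_def line_through_def span)
qed

lemma line_through_parallel:
  assumes "line_through a u = line_through b v" "v \<noteq> 0"
  shows "line_through c u = line_through c v"
proof -
  have "b \<in> line_through b v" "b + v \<in> line_through b v"
    by (auto simp: line_through_def intro: exI[of _ 0] exI[of _ 1])
  then have "b \<in> line_through a u" "b + v \<in> line_through a u"
    using assms(1) by auto
  then obtain s t where "b = a + s *\<^sub>R u" "b + v = a + t *\<^sub>R u"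
    unfolding line_through_def by blast
  then have v: "v = (t - s) *\<^sub>R u" by (simp add: algebra_simps)
  with assms(2) have "t - s \<noteq> 0" by auto
  show ?thesis
  proof (intro set_eqI iffI)
    fix x assume "x \<in> line_through c u"
    then obtain p where "x = c + p *\<^sub>R u" unfolding line_through_def by blast
    then have "x = c + (p / (t - s)) *\<^sub>R v" using \<open>t - s \<noteq> 0\<close> by (simp add: v)
    then show "x \<in> line_through c v" unfolding line_through_def by blast
  next
    fix x assume "x \<in> line_through c v"
    then obtain p where "x = c + p *\<^sub>R v" unfolding line_through_def by blast
    then have "x = c + (p * (t - s)) *\<^sub>R u" by (simp add: v)
    then show "x \<in> line_through c u" unfolding line_through_def by blast
  qed
qed

section \<open>Independence of the labels\<close>

lemma range_relabel: "range (\<lambda>i. Q (i + s)) = range Q" for s :: 5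
proof -
  have "Q i \<in> range (\<lambda>i. Q (i + s))" for i
    by (rule range_eqI[of _ _ "i - s"]) simp
  then show ?thesis by auto
qed

lemma diam_relabel: "diam (\<lambda>i. Q (i + s)) = diam Q"
  unfolding diam_def range_relabel ..

lemma max_dist_to_line_relabel: "max_dist_to_line (\<lambda>i. Q (i + s)) l = max_dist_to_line Q l"
  unfolding max_dist_to_line_def using range_relabel[of "\<lambda>i. infdist (Q i) l" s] by simp

lemma centroid_relabel: "centroid (\<lambda>i. Q (i + s)) = centroid Q"
  by (simp add: centroid_def sum_relabel)

lemma area_relabel: "area (\<lambda>i. Q (i + s)) = area Q"
  using sum_relabel[of "\<lambda>i. det2 (Q i) (Q (i + 1))" s] by (simp add: area_def ac_simps)

lemma powr_half_nat: "x > 0 \<Longrightarrow> x powr (real k / 2) = sqrt x ^ k"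
  by (simp add: powr_half_sqrt[symmetric] powr_powr flip: powr_realpow)

text \<open>The image of a lift is divided by its third coordinate; \<open>d i k\<close> is that
  coordinate relative to \<open>m1 ^ k * \<alpha> i\<close>. Removing the third coordinates of
  \<open>w2\<close> and \<open>w3\<close> turns them into directions at the limit point.\<close>

lemma iterated_pentagram_coordinates:
  fixes P :: pentagon
  assumes conv: "convex_lifts \<sigma> (\<lambda>i. lift (P i))"
  defines "G \<equiv> shifted_glick (\<lambda>i. lift (P i))"
  assumes detG: "det (matrix G) \<noteq> 0"
    and ev: "G w1 = m1 *\<^sub>R w1" "G w2 = m2 *\<^sub>R w2" "G w3 = m3 *\<^sub>R w3"
    and m: "m1 > 0" "\<bar>m2\<bar> < m1" "\<bar>m3\<bar> < m1" and det: "det3 w1 w2 w3 \<noteq> 0"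
    and w1: "w1 $ 3 = 1"
    and coord: "\<And>i. lift (P i) = \<alpha> i *\<^sub>R w1 + \<beta> i *\<^sub>R w2 + \<gamma> i *\<^sub>R w3"
  obtains d where "\<And>i. d i \<longlonglongrightarrow> 1"
    "\<And>k i. (pentagram ^^ k) P (i + of_nat k) = affine_part w1
      + ((m2 / m1) ^ k * (\<beta> i / \<alpha> i / d i k)) *\<^sub>R affine_part (w2 - w2 $ 3 *\<^sub>R w1)
      + ((m3 / m1) ^ k * (\<gamma> i / \<alpha> i / d i k)) *\<^sub>R affine_part (w3 - w3 $ 3 *\<^sub>R w1)"
proof -
  have lin: "linear G" by (simp add: G_def linear_shifted_glick)
  have \<alpha>: "\<alpha> i > 0" for i
    using dominant_coordinate_pos[OF conv ev[unfolded G_def] m det coord, of i] w1 by simp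
  define d where "d i k = 1 + (m2 / m1) ^ k * (\<beta> i / \<alpha> i) * w2 $ 3 + (m3 / m1) ^ k * (\<gamma> i / \<alpha> i) *
      w3 $ 3" for i k
  have "d i \<longlonglongrightarrow> 1 + 0 * (\<beta> i / \<alpha> i) * w2 $ 3 + 0 * (\<gamma> i / \<alpha> i) * w3 $ 3" for i
    unfolding d_def by (intro tendsto_intros) (use m in auto)
  then have lim: "d i \<longlonglongrightarrow> 1" for i by simp
  have "(pentagram ^^ k) P (i + of_nat k) = affine_part w1
      + ((m2 / m1) ^ k * (\<beta> i / \<alpha> i / d i k)) *\<^sub>R affine_part (w2 - w2 $ 3 *\<^sub>R w1)
      + ((m3 / m1) ^ k * (\<gamma> i / \<alpha> i / d i k)) *\<^sub>R affine_part (w3 - w3 $ 3 *\<^sub>R w1)" (is "?x = ?y")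
          for k i
  proof -
    obtain t where t: "t > 0" "(G ^^ k) (lift (P i)) = t *\<^sub>R lift ?x"
      using pentagram_funpow[OF conv detG[unfolded G_def], of k] unfolding G_def by blast
    define R where "R = (m2 / m1) ^ k * (\<beta> i / \<alpha> i)"
    define S where "S = (m3 / m1) ^ k * (\<gamma> i / \<alpha> i)"
    have dk: "d i k = 1 + R * w2 $ 3 + S * w3 $ 3" by (simp add: d_def R_def S_def)
    have m1: "m1 ^ k > 0" using m(1) by simp
    note link = linear_funpow[OF lin, of k]
    have "(G ^^ k) (lift (P i)) = (m1 ^ k * \<alpha> i) *\<^sub>R w1 + (m2 ^ k * \<beta> i) *\<^sub>R w2 + (m3 ^ k * \<gamma> i) *\<^sub>R w3"
      unfolding coord[of i] linear_add[OF link] linear_cmul[OF link] funpow_eigenvector[OF lin ev(1)]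
        funpow_eigenvector[OF lin ev(2)] funpow_eigenvector[OF lin ev(3)]
      by (simp add: mult.commute)
    also have "\<dots> = (m1 ^ k * \<alpha> i) *\<^sub>R (w1 + R *\<^sub>R w2 + S *\<^sub>R w3)"
      using m(1) \<alpha>[of i] by (simp add: R_def S_def scaleR_add_right power_divide)
    finally have eq: "t *\<^sub>R lift ?x = (m1 ^ k * \<alpha> i) *\<^sub>R (w1 + R *\<^sub>R w2 + S *\<^sub>R w3)"
      by (simp only: t(2))
    have t': "t = m1 ^ k * \<alpha> i * d i k"
      using arg_cong[OF eq, of "\<lambda>v. v $ 3"] w1 by (simp add: dk)
    have "0 < m1 ^ k * \<alpha> i" using m1 \<alpha>[of i] by simp
    with t(1) t' have "d i k > 0" by (metis zero_less_mult_pos)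
    have "d i k *\<^sub>R lift ?x = w1 + R *\<^sub>R w2 + S *\<^sub>R w3"
      using eq m(1) \<alpha>[of i] unfolding t' by (simp flip: scaleR_scaleR)
    also have "\<dots> = d i k *\<^sub>R w1 + R *\<^sub>R (w2 - w2 $ 3 *\<^sub>R w1) + S *\<^sub>R (w3 - w3 $ 3 *\<^sub>R w1)"
      by (simp add: dk algebra_simps)
    also have "\<dots> = d i k *\<^sub>R (w1 + (R / d i k) *\<^sub>R (w2 - w2 $ 3 *\<^sub>R w1) + (S / d i k) *\<^sub>R (w3 - w3 $
        3 *\<^sub>R w1))"
      using \<open>d i k > 0\<close> by (simp add: scaleR_add_right)
    finally have L: "lift ?x = w1 + (R / d i k) *\<^sub>R (w2 - w2 $ 3 *\<^sub>R w1) + (S / d i k) *\<^sub>R (w3 - w3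
        $ 3 *\<^sub>R w1)"
      using \<open>d i k > 0\<close> by (metis scaleR_left_imp_eq less_irrefl)
    have "affine_part (lift ?x) = ?x" by (simp add: vec_eq_iff forall_2)
    moreover have "affine_part (u + r *\<^sub>R v + s *\<^sub>R w) = affine_part u + r *\<^sub>R affine_part v + s *\<^sub>R
        affine_part w" for u v w r s
      by (simp add: vec_eq_iff forall_2)
    ultimately show ?thesis
      using L by (metis R_def S_def times_divide_eq_right)
  qed
  with lim that show ?thesis by blast
qed

text \<open>As all \<open>\<alpha> i\<close> are positive, the quotients are the coordinates of
  \<open>P\<close> in the affine chart of the eigenbasis, where it is again a convex pentagon; the
  sum is twice its signed area and becomes the leading coefficient of the area of the
  iterates.\<close>

lemma projected_area_nonzero:
  fixes P :: pentagon
  assumes conv: "convex_lifts \<sigma> (\<lambda>i. lift (P i))" and "\<And>i. \<alpha> i > 0" and det: "det3 w1 w2 w3 \<noteq> 0"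
    and coord: "\<And>i. lift (P i) = \<alpha> i *\<^sub>R w1 + \<beta> i *\<^sub>R w2 + \<gamma> i *\<^sub>R w3"
  defines "b \<equiv> \<lambda>i. \<beta> i / \<alpha> i" and "g \<equiv> \<lambda>i. \<gamma> i / \<alpha> i"
  shows "(\<Sum>i\<in>UNIV. b i * g (i + 1) - b (i + 1) * g i) \<noteq> 0"
proof -
  define B :: pentagon where "B i = vector [b i, g i]" for i
  have "convex_lifts (\<sigma> * det3 w1 w2 w3) (\<lambda>i. lift (B i))"
  proof -
    have "0 < \<sigma> * det3 w1 w2 w3 * det3 (lift (B i)) (lift (B j)) (lift (B k))"
      if pos: "0 < \<sigma> * det3 (lift (P i)) (lift (P j)) (lift (P k))" for i j k
    proof -
      have \<beta>: "\<beta> i = \<alpha> i * b i" "\<gamma> i = \<alpha> i * g i" for i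
        using assms(2)[of i] by (simp_all add: b_def g_def)
      have e: "det3 (lift (B i)) (lift (B j)) (lift (B k))
         = b i * g j + g i * b k + b j * g k - b i * g k - g i * b j - g j * b k"
        by (simp add: det3_expand B_def)
      have "det3 (lift (P i)) (lift (P j)) (lift (P k))
         = (\<alpha> i * \<alpha> j * \<alpha> k) * (det3 w1 w2 w3 * det3 (lift (B i)) (lift (B j)) (lift (B k)))"
        unfolding coord det3_lincomb \<beta> e by (simp add: algebra_simps)
      with pos have "0 < (\<alpha> i * \<alpha> j * \<alpha> k) * (\<sigma> * det3 w1 w2 w3 * det3 (lift (B i)) (lift (B j))
          (lift (B k)))"
        by (simp add: mult_ac)
      moreover have "0 < \<alpha> i * \<alpha> j * \<alpha> k" using assms(2) by simp
      ultimately show ?thesis by (rule zero_less_mult_pos)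
    qed
    with conv show ?thesis unfolding convex_lifts_def by blast
  qed
  then have "area B > 0" by (rule area_pos)
  moreover have "det2 (B i) (B (i + 1)) = b i * g (i + 1) - b (i + 1) * g i" for i
    by (simp add: det2_expand B_def)
  ultimately show ?thesis by (auto simp: area_def)
qed

theorem corollary5p20:
  fixes P :: pentagon
  assumes "strictly_convex_pentagon P"
    and "\<not> (\<exists>Q. regular_pentagon Q \<and> projectively_equivalent P Q)"
  shows "(\<exists>\<mu>1 \<mu>2 \<mu>3. ordered_eigenvalues (glick_shifted P) \<mu>1 \<mu>2 \<mu>3) \<and>
    (\<forall>\<mu>1 \<mu>2 \<mu>3 v1 v2.
      ordered_eigenvalues (glick_shifted P) \<mu>1 \<mu>2 \<mu>3 \<longrightarrow>
      eigenvector_for (glick_shifted P) \<mu>1 v1 \<longrightarrow>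
      eigenvector_for (glick_shifted P) \<mu>2 v2 \<longrightarrow>
        (\<exists>u. affine_direction v1 v2 u) \<and>
        (\<forall>u. affine_direction v1 v2 u \<longrightarrow>
          (\<lambda>k. max_dist_to_line ((normalized_pentagram ^^ k) P) (line_through (centroid P) u))
            \<longlonglongrightarrow> 0 \<and>
          filterlim (\<lambda>k. diam ((normalized_pentagram ^^ k) P)) at_top sequentially \<and>
          (\<lambda>k. max_dist_to_line ((normalized_pentagram ^^ k) P) (line_through (centroid P) u))
            \<in> O(\<lambda>k. \<bar>\<mu>3 / \<mu>2\<bar> powr (real k / 2)) \<and>
          (\<exists>D>0. (\<lambda>k. diam ((normalized_pentagram ^^ k) P))
            \<sim>[sequentially] (\<lambda>k. D * \<bar>\<mu>2 / \<mu>3\<bar> powr (real k / 2)))))"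
proof -
  obtain \<sigma> where conv: "convex_lifts \<sigma> (\<lambda>i. lift (P i))"
    using strictly_convex_imp_convex_lifts[OF assms(1)] .
  define G where "G = shifted_glick (\<lambda>i. lift (P i))"
  have glick: "glick_shifted P = G" by (simp add: G_def glick_shifted_eq)
  have lin: "linear G" by (simp add: G_def linear_shifted_glick)
  obtain l1 l2 l3 where l: "l1 > 0" "l3 \<noteq> 0" "ordered_eigenvalues G l1 l2 l3"
    using shifted_glick_spectrum[OF conv assms(2)] unfolding G_def by metis
  show ?thesis
    unfolding glick
  proof (intro conjI allI impI)
    show "\<exists>\<mu>1 \<mu>2 \<mu>3. ordered_eigenvalues G \<mu>1 \<mu>2 \<mu>3" using l(3) by blast
  next
    fix \<mu>1 \<mu>2 \<mu>3 v1 v2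
    assume ord: "ordered_eigenvalues G \<mu>1 \<mu>2 \<mu>3"
      and v1: "eigenvector_for G \<mu>1 v1" and v2: "eigenvector_for G \<mu>2 v2"
    have set: "{\<mu>1, \<mu>2, \<mu>3} = {l1, l2, l3}" and spec: "eigenvalues G = {\<mu>1, \<mu>2, \<mu>3}"
      and abs: "\<bar>\<mu>1\<bar> > \<bar>\<mu>2\<bar>" "\<bar>\<mu>2\<bar> > \<bar>\<mu>3\<bar>"
      using ord l(3) by (auto simp: ordered_eigenvalues_def)
    have labs: "\<bar>l1\<bar> > \<bar>l2\<bar>" "\<bar>l2\<bar> > \<bar>l3\<bar>" using l(3) by (auto simp: ordered_eigenvalues_def)
    \<comment> \<open>The strictly largest modulus identifies the eigenvalue, and positivity carries
      over from \<open>l1\<close>.\<close>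
    have "\<mu>1 = l1"
    proof (rule ccontr)
      assume "\<mu>1 \<noteq> l1"
      moreover have "\<mu>1 \<in> {l1, l2, l3}" "l1 \<in> {\<mu>1, \<mu>2, \<mu>3}" using set by blast+
      ultimately show False using labs abs by auto
    qed
    have "\<mu>1 > 0" using \<open>\<mu>1 = l1\<close> l(1) by simp
    have "\<mu>3 \<noteq> 0"
    proof
      assume "\<mu>3 = 0"
      then have "0 \<in> {l1, l2, l3}" using set by blast
      with l labs show False by auto
    qed
    have "\<mu>2 \<noteq> 0" using abs by auto
    have "\<mu>3 \<in> eigenvalues G" using spec by blast
    then obtain v3 where v3: "eigenvector_for G \<mu>3 v3" by (auto simp: eigenvalues_def)
    have detG: "det (matrix G) \<noteq> 0"
    proof
      assume "det (matrix G) = 0"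
      then have "det3 (G v1) (G v2) (G v3) = 0" by (simp add: det3_linear[OF lin])
      moreover have "det3 v1 v2 v3 \<noteq> 0"
        by (rule eigenvectors_det3_nonzero[OF lin v1 v2 v3]) (use abs in auto)
      ultimately obtain x where "x \<noteq> 0" "G x = 0"
        using kernel_iff_det3_zero[OF lin] by blast
      then have "0 \<in> eigenvalues G" by (auto simp: eigenvalues_def eigenvector_for_def)
      with spec \<open>\<mu>1 > 0\<close> \<open>\<mu>2 \<noteq> 0\<close> \<open>\<mu>3 \<noteq> 0\<close> show False by auto
    qed
    have v1': "det3 v1 v2 v3 \<noteq> 0"
      by (rule eigenvectors_det3_nonzero[OF lin v1 v2 v3]) (use abs in auto)
    have Gv: "G v1 = \<mu>1 *\<^sub>R v1" "G v2 = \<mu>2 *\<^sub>R v2" "G v3 = \<mu>3 *\<^sub>R v3"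
      using v1 v2 v3 by (auto simp: eigenvector_for_def)
    have m: "\<mu>1 > 0" "\<bar>\<mu>2\<bar> < \<mu>1" "\<bar>\<mu>3\<bar> < \<mu>1" using \<open>\<mu>1 > 0\<close> abs by auto
    have comb: "x = (det3 x y z / det3 w y z) *\<^sub>R w + (det3 w x z / det3 w y z) *\<^sub>R y + (det3 w y x
        / det3 w y z) *\<^sub>R z"
      if "det3 w y z \<noteq> 0" for w x y z
    proof -
      have "x = (1 / det3 w y z) *\<^sub>R (det3 w y z *\<^sub>R x)" using that by simp
      also note cramer3[of w y z x]
      finally show ?thesis by (simp add: scaleR_right_distrib)
    qed
    \<comment> \<open>The dominant eigenpoint is not at infinity, so the line through the first two
      eigenpoints has an affine direction.\<close>
    have "v1 $ 3 \<noteq> 0"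
      using dominant_coordinate_pos[OF conv Gv[unfolded G_def] m v1' comb[OF v1'], of 0] by auto
    define w1 where "w1 = (1 / v1 $ 3) *\<^sub>R v1"
    have v1_eq: "v1 = (v1 $ 3) *\<^sub>R w1" using \<open>v1 $ 3 \<noteq> 0\<close> by (simp add: w1_def)
    have w1: "w1 $ 3 = 1" "G w1 = \<mu>1 *\<^sub>R w1"
      using \<open>v1 $ 3 \<noteq> 0\<close> by (simp_all add: w1_def linear_cmul[OF lin] Gv)
    have det: "det3 w1 v2 v3 \<noteq> 0"
      using det3_scale[of "1 / v1 $ 3" v1 1 v2 1 v3] v1' \<open>v1 $ 3 \<noteq> 0\<close> by (simp add: w1_def)
    define U where "U = affine_part (v2 - v2 $ 3 *\<^sub>R w1)"
    define Z where "Z = affine_part (v3 - v3 $ 3 *\<^sub>R w1)"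
    \<comment> \<open>Subtracting multiples of \<open>w1\<close> clears the third coordinates, so
      independence of the eigenvectors becomes independence of the two directions.\<close>
    have "det2 U Z = det3 w1 v2 v3"
      using w1(1) by (simp add: U_def Z_def det2_expand det3_expand algebra_simps)
    with det have UZ: "det2 U Z \<noteq> 0" by simp
    then have "U \<noteq> 0" by (auto simp: det2_expand)
    have line: "line_affine_part v1 v2 = line_through (affine_part w1) U"
      using line_affine_part_eq[OF w1(1) \<open>v1 $ 3 \<noteq> 0\<close>, of v2] by (simp add: U_def flip: v1_eq)
    show "\<exists>u. affine_direction v1 v2 u"
      using line \<open>U \<noteq> 0\<close> by (auto simp: affine_direction_def)

    define \<alpha> where "\<alpha> i = det3 (lift (P i)) v2 v3 / det3 w1 v2 v3" for i
    define \<beta> where "\<beta> i = det3 w1 (lift (P i)) v3 / det3 w1 v2 v3" for i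
    define \<gamma> where "\<gamma> i = det3 w1 v2 (lift (P i)) / det3 w1 v2 v3" for i
    have coord: "lift (P i) = \<alpha> i *\<^sub>R w1 + \<beta> i *\<^sub>R v2 + \<gamma> i *\<^sub>R v3" for i
      unfolding \<alpha>_def \<beta>_def \<gamma>_def by (rule comb[OF det])
    have \<alpha>: "\<alpha> i > 0" for i
      using dominant_coordinate_pos[OF conv w1(2)[unfolded G_def] Gv(2,3)[unfolded G_def] m det
          coord, of i] w1(1)
      by simp
    define r where "r = \<mu>2 / \<mu>1"
    define s where "s = \<mu>3 / \<mu>1"
    have rs: "r \<noteq> 0" "s \<noteq> 0" "\<bar>s\<bar> < \<bar>r\<bar>" "s / r = \<mu>3 / \<mu>2"
      using \<open>\<mu>1 > 0\<close> \<open>\<mu>2 \<noteq> 0\<close> \<open>\<mu>3 \<noteq> 0\<close> abs by (auto simp: r_def s_def abs_divide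
          divide_strict_right_mono)
    define q where "q = sqrt \<bar>s / r\<bar>"
    have q: "0 < q" "q < 1" using rs abs \<open>\<mu>3 \<noteq> 0\<close> \<open>\<mu>2 \<noteq> 0\<close> by (auto simp: q_def)
    obtain d where d: "\<And>i. d i \<longlonglongrightarrow> 1" and X: "\<And>k i. (pentagram ^^ k) P (i + of_nat k)
      = affine_part w1 + (r ^ k * (\<beta> i / \<alpha> i / d i k)) *\<^sub>R U + (s ^ k * (\<gamma> i / \<alpha> i / d i k)) *\<^sub>R Z"
      using iterated_pentagram_coordinates[OF conv detG[unfolded G_def] w1(2)[unfolded G_def]
          Gv(2,3)[unfolded G_def] m det w1(1) coord]
      unfolding r_def s_def U_def Z_def by metis
    have lims: "(\<lambda>k. \<beta> i / \<alpha> i / d i k) \<longlonglongrightarrow> \<beta> i / \<alpha> i" "(\<lambda>k. \<gamma> i / \<alpha> i / d i k) \<longlonglongrightarrow> \<gamma> i / \<alpha> i" for i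
      using tendsto_divide[OF tendsto_const d[of i], of "\<beta> i / \<alpha> i"] tendsto_divide[OF tendsto_const
          d[of i], of "\<gamma> i / \<alpha> i"]
      by simp_all
    have convk: "\<exists>\<sigma>. convex_lifts \<sigma> (\<lambda>i. lift ((pentagram ^^ k) P i))" for k
      using pentagram_funpow[OF conv detG[unfolded G_def]] by blast
    have "area P > 0" using area_pos[OF conv] .
    define N where "N k = (normalized_pentagram ^^ k) P" for k
    \<comment> \<open>The operator shifts the label by one in each step, so the coordinates describe
      the iterate relabelled by \<open>k\<close>; area, centroid, diameter and distance do not see
      this.\<close>
    have N: "N k (i + of_nat k) = centroid P
      + sqrt (area P / area (\<lambda>i. (pentagram ^^ k) P (i + of_nat k))) *\<^sub>R ((pentagram ^^ k) P (i +
          of_nat k)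
        - centroid (\<lambda>i. (pentagram ^^ k) P (i + of_nat k)))" for k i
      unfolding N_def normalized_pentagram_funpow[OF convk] area_relabel centroid_relabel ..
    note asymp = rescaled_pentagon_asymptotics[where N = "\<lambda>k i. N k (i + of_nat k)", OF X N lims
        projected_area_nonzero[OF conv \<alpha> det coord] UZ rs(1-3) \<open>area P > 0\<close>,
        unfolded diam_relabel max_dist_to_line_relabel, folded q_def]
    obtain B where B: "convergent B" "\<And>k. max_dist_to_line (N k) (line_through (centroid P) U) \<le> B k
        * q ^ k"
      using asymp(1) by blast
    obtain D where D: "D > 0" "(\<lambda>k. diam (N k) * q ^ k) \<longlonglongrightarrow> D"
      using asymp(2) by blast
    have powr: "\<bar>\<mu>3 / \<mu>2\<bar> powr (real k / 2) = q ^ k" "\<bar>\<mu>2 / \<mu>3\<bar> powr (real k / 2) = 1 / q ^ k" for k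
    proof -
      show *: "\<bar>\<mu>3 / \<mu>2\<bar> powr (real k / 2) = q ^ k"
        unfolding q_def rs(4) by (rule powr_half_nat) (use \<open>\<mu>2 \<noteq> 0\<close> \<open>\<mu>3 \<noteq> 0\<close> in simp)
      have "\<bar>\<mu>2 / \<mu>3\<bar> = inverse \<bar>\<mu>3 / \<mu>2\<bar>" by (simp add: abs_divide)
      then show "\<bar>\<mu>2 / \<mu>3\<bar> powr (real k / 2) = 1 / q ^ k"
        unfolding *[symmetric] inverse_eq_divide[symmetric] by (simp only: inverse_powr abs_ge_zero)
    qed
    fix u assume u: "affine_direction v1 v2 u"
    \<comment> \<open>Every admissible \<open>u\<close> is a multiple of \<open>U\<close>, so the
      estimates obtained for \<open>U\<close> carry over.\<close>
    have Cu: "line_through (centroid P) u = line_through (centroid P) U"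
    proof -
      obtain a where "line_through (affine_part w1) U = line_through a u"
        using u line by (auto simp: affine_direction_def)
      then show ?thesis using \<open>U \<noteq> 0\<close> by (metis line_through_parallel)
    qed
    have pos: "0 \<le> max_dist_to_line Q l" for Q l
      unfolding max_dist_to_line_def by (subst Max_ge_iff) (auto simp: infdist_nonneg)
    obtain K where K: "\<And>k. \<bar>B k\<bar> \<le> K"
      using convergent_imp_Bseq[OF B(1)] by (auto simp: Bseq_def)
    show O: "(\<lambda>k. max_dist_to_line ((normalized_pentagram ^^ k) P) (line_through (centroid P) u))
      \<in> O(\<lambda>k. \<bar>\<mu>3 / \<mu>2\<bar> powr (real k / 2))"
    proof (rule bigoI[of _ K], intro always_eventually allI)
      fix k
      have "max_dist_to_line (N k) (line_through (centroid P) U) \<le> K * q ^ k"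
        using B(2)[of k] K[of k] q(1) by (smt (verit) mult_right_mono zero_le_power)
      then show "norm (max_dist_to_line ((normalized_pentagram ^^ k) P) (line_through (centroid P) u))
        \<le> K * norm (\<bar>\<mu>3 / \<mu>2\<bar> powr (real k / 2))"
        using pos[of "N k"] q(1) unfolding powr Cu N_def by simp
    qed
    have q0: "(\<lambda>k. q ^ k) \<longlonglongrightarrow> 0" using q by (intro LIMSEQ_power_zero) simp
    show "(\<lambda>k. max_dist_to_line ((normalized_pentagram ^^ k) P) (line_through (centroid P) u)) \<longlonglongrightarrow> 0"
    proof (rule tendsto_sandwich[OF _ _ tendsto_const])
      have "B \<longlonglongrightarrow> lim B" using B(1) by (simp add: convergent_LIMSEQ_iff)
      from tendsto_mult[OF this q0] show "(\<lambda>k. B k * q ^ k) \<longlonglongrightarrow> 0" by simp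
    qed (use B(2) pos in \<open>auto simp: Cu N_def\<close>)
    show "filterlim (\<lambda>k. diam ((normalized_pentagram ^^ k) P)) at_top sequentially"
    proof -
      have "filterlim (\<lambda>k. inverse (q ^ k)) at_top sequentially"
        using q0 q(1) by (intro filterlim_inverse_at_top) auto
      from filterlim_tendsto_pos_mult_at_top[OF D(2) D(1) this]
      show ?thesis using q(1) by (simp add: N_def field_simps)
    qed
    show "\<exists>D>0. (\<lambda>k. diam ((normalized_pentagram ^^ k) P))
      \<sim>[sequentially] (\<lambda>k. D * \<bar>\<mu>2 / \<mu>3\<bar> powr (real k / 2))"
    proof (intro exI conjI)
      show "D > 0" by fact
      have "(\<lambda>k. diam (N k) * q ^ k / D) \<longlonglongrightarrow> D / D" using D by (intro tendsto_intros) auto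
      then have "(\<lambda>k. diam (N k) / (D * (1 / q ^ k))) \<longlonglongrightarrow> 1" using D(1) by (simp add: field_simps)
      then show "(\<lambda>k. diam ((normalized_pentagram ^^ k) P)) \<sim>[sequentially] (\<lambda>k. D * \<bar>\<mu>2 / \<mu>3\<bar> powr
          (real k / 2))"
        unfolding powr N_def by (rule asymp_equivI')
    qed
  qed
qed

end
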